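(* For every integer $t\geq 14$ there is $k_0$ such that for all integers $k>k_0$ and $n\geq (t+1)(k-t+1)$ the following holds. If $\mathcal{A}\subset\binom{[n]}{k}$ and $\mathcal{B}\subset\binom{[n]}{k}$ are cross $t$-intersecting, then $$|\mathcal{A}||\mathcal{B}|\leq\binom{n-t}{k-t}^2,$$ with equality if and only if $\mathcal{A}=\mathcal{B}\cong\mathcal{F}_0^t(n,k)$, or $n=(t+1)(k-t+1)$ and $\mathcal{A}=\mathcal{B}\cong\mathcal{F}_1^t(n,k)$.
   Context: $\binom{[n]}{k}$ is the set of $k$-subsets of $[n]$. Families are cross $t$-intersecting if $|A\cap B|\ge t$ for all $A\in\mathcal{A},B\in\mathcal{B}$. $\mathcal{F}_i^t(n,k)=\{F\in\binom{[n]}{k}:|F\cap[t+2i]|\geq t+i\}$. Two families are isomorphic ($\cong$) if one is obtained from the other by applying a permutation of $[n]$ to every member. *)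

theory Defs
  imports "HOL-Library.Ramsey" "HOL-Combinatorics.Permutations"
begin

text \<open>The ground set \<open>[n]\<close> is \<open>{1..n}\<close>, and the set of its \<open>k\<close>-subsets is \<open>nsets {1..n} k\<close>.\<close>

definition cross_intersecting :: "nat \<Rightarrow> 'a set set \<Rightarrow> 'a set set \<Rightarrow> bool" where
  "cross_intersecting t \<A> \<B> \<longleftrightarrow> (\<forall>A\<in>\<A>. \<forall>B\<in>\<B>. card (A \<inter> B) \<ge> t)"

definition frankl_family :: "nat \<Rightarrow> nat \<Rightarrow> nat \<Rightarrow> nat \<Rightarrow> nat set set" where
  "frankl_family i t n k = {F \<in> nsets {1..n} k. card (F \<inter> {1..t + 2 * i}) \<ge> t + i}"

definition family_iso :: "nat \<Rightarrow> nat set set \<Rightarrow> nat set set \<Rightarrow> bool" where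
  "family_iso n \<A> \<B> \<longleftrightarrow> (\<exists>\<pi>. \<pi> permutes {1..n} \<and> \<B> = (\<lambda>F. \<pi> ` F) ` \<A>)"

end

theory Submission
  imports Defs Complex_Main
begin

text \<open>Take a pair maximising the product of sizes and shift it. If \<open>l\<close> is least such that membership
in both families is decided by the trace on \<open>[l]\<close>, then the traces are cross \<open>t\<close>-intersecting, and two
traces that cannot both spare the point \<open>l\<close> have union \<open>[l]\<close> and hence sizes \<open>i\<close> and \<open>j\<close> with
\<open>i + j = l + t\<close>. Dropping \<open>l\<close> from the size-\<open>i\<close> traces of one family, and discarding the size-\<open>j\<close>
ones of the other (or vice versa), must not increase the product. Let \<open>x\<close> and \<open>y\<close> be the fractions of the
two families carried by these traces; shiftedness gives \<open>x \<le> i/l\<close> and \<open>y \<le> j/l\<close>, while the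
exchanges give \<open>r x (1 - y) \<le> y\<close> and \<open>r' y (1 - x) \<le> x\<close> with \<open>r \<ge> t\<close> and \<open>r' \<ge> t - 1\<close>. This is
impossible unless \<open>i = l\<close>, \<open>j = l\<close> or \<open>i = j = t + 1\<close>, and those cases are counted directly. Finally a
shift can be undone because the sets on which a preimage of an extremal family is ambiguous form a
connected bipartite Kneser-type graph.\<close>

section \<open>Traces and Frankl families\<close>

text \<open>The two exchange inequalities do not conflict by themselves: they hold at
  \<open>x = y = 1\<close>. What breaks them is the bound from shiftedness. Since
  \<open>1 - y\<close> is at least \<open>(i - t)/l\<close>, the first exchange keeps
  \<open>x\<close> below about 1/2 once \<open>i \<ge> j > t\<close> and
  \<open>i \<ge> t + 2\<close>; the second then makes \<open>y\<close> tiny, while both together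
  make \<open>1 - y\<close> tiny. For \<open>i = l\<close> the bound on \<open>x\<close> is void,
  and for \<open>i = j = t + 1\<close> the four inequalities are consistent, as they have to be: at
  \<open>n = (t + 1) * (k - t + 1)\<close> the second Frankl family ties with the first. Uniqueness
  is the other obstacle. A shifted pair forgets the original one, so only maximisers are analysed,
  their structure is carried back one shift at a time, and the upper bound is read off as the
  product of a maximiser.\<close>

definition trace_family :: "nat \<Rightarrow> nat \<Rightarrow> nat set \<Rightarrow> nat set set \<Rightarrow> nat set set" where
  "trace_family n k S \<X> = {F \<in> nsets {1..n} k. F \<inter> S \<in> \<X>}"

text \<open>Such a set is \<open>X\<close> plus a free choice outside \<open>S\<close>. The bound
  \<open>card X \<le> k\<close> keeps \<open>k - card X\<close> from truncating to 0, which would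
  count one set where there is none.\<close>

lemma card_nsets_trace:
  assumes "finite V" "S \<subseteq> V" "X \<subseteq> S" "card X \<le> k"
  shows "card {F \<in> nsets V k. F \<inter> S = X} = (card V - card S) choose (k - card X)"
proof -
  have fS: "finite S" using finite_subset[OF assms(2,1)] .
  have fX: "finite X" using finite_subset[OF assms(3) fS] .
  have "bij_betw (\<lambda>U. X \<union> U) {U. U \<subseteq> V - S \<and> card U = k - card X} {F \<in> nsets V k. F \<inter> S = X}"
  proof (rule bij_betw_byWitness[where f' = "\<lambda>F. F - S"])
    show "\<forall>U\<in>{U. U \<subseteq> V - S \<and> card U = k - card X}. X \<union> U - S = U" using assms by auto
    show "\<forall>F\<in>{F \<in> nsets V k. F \<inter> S = X}. X \<union> (F - S) = F" by auto
    show "(\<union>) X ` {U. U \<subseteq> V - S \<and> card U = k - card X} \<subseteq> {F \<in> nsets V k. F \<inter> S = X}"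
    proof clarsimp
      fix U assume U: "U \<subseteq> V - S" "card U = k - card X"
      have fU: "finite U" using finite_subset[OF U(1)] assms(1) by simp
      have "card (X \<union> U) = card X + card U"
        by (rule card_Un_disjoint) (use fX fU U assms in auto)
      then show "X \<union> U \<in> nsets V k \<and> (X \<union> U) \<inter> S = X"
        using U assms fX fU by (auto simp: nsets_def)
    qed
    show "(\<lambda>F. F - S) ` {F \<in> nsets V k. F \<inter> S = X} \<subseteq> {U. U \<subseteq> V - S \<and> card U = k - card X}"
    proof clarify
      fix F assume F: "F \<in> nsets V k"
      have "card (F - S) = card F - card (F \<inter> S)" by (rule card_Diff_subset_Int) (use fS in simp)
      then show "F - S \<subseteq> V - S \<and> card (F - S) = k - card (F \<inter> S)"
        using F by (auto simp: nsets_def)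
    qed
  qed
  then have "card {F \<in> nsets V k. F \<inter> S = X} = card {U. U \<subseteq> V - S \<and> card U = k - card X}"
    by (simp add: bij_betw_same_card)
  also have "\<dots> = card (V - S) choose (k - card X)" using assms by (simp add: n_subsets)
  finally show ?thesis using assms fS by (simp add: card_Diff_subset)
qed

lemma finite_nsets_atLeastAtMost [simp]: "finite (nsets {m..n::nat} k)"
  by (simp add: finite_imp_finite_nsets)

lemma card_trace_family:
  assumes "S \<subseteq> {1..n}" "\<X> \<subseteq> Pow S" "\<And>X. X \<in> \<X> \<Longrightarrow> card X \<le> k"
  shows "card (trace_family n k S \<X>) = (\<Sum>X\<in>\<X>. (n - card S) choose (k - card X))"
proof -
  have fS: "finite S" using finite_subset[OF assms(1)] by simp
  have f: "finite \<X>" using finite_subset[OF assms(2)] fS by simp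
  have "trace_family n k S \<X> = (\<Union>X\<in>\<X>. {F \<in> nsets {1..n} k. F \<inter> S = X})"
    by (auto simp: trace_family_def)
  also have "card \<dots> = (\<Sum>X\<in>\<X>. card {F \<in> nsets {1..n} k. F \<inter> S = X})"
    by (rule card_UN_disjoint) (use f in auto)
  also have "\<dots> = (\<Sum>X\<in>\<X>. (n - card S) choose (k - card X))"
    using assms card_nsets_trace[of "{1..n}" S] by (intro sum.cong refl) auto
  finally show ?thesis .
qed

lemma card_trace_family_level:
  assumes "S \<subseteq> {1..n}" "\<X> \<subseteq> Pow S" "\<And>X. X \<in> \<X> \<Longrightarrow> card X = i" "i \<le> k"
  shows "card (trace_family n k S \<X>) = card \<X> * ((n - card S) choose (k - i))"
  using card_trace_family[OF assms(1,2), of k] assms(3,4) by simp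

text \<open>A copy of a Frankl family on an arbitrary \<open>S\<close>: undoing a shift can move
  \<open>S\<close>, so initial segments do not suffice.\<close>

definition heavy :: "nat \<Rightarrow> nat \<Rightarrow> nat \<Rightarrow> nat set \<Rightarrow> nat set set" where
  "heavy n k m S = {F \<in> nsets {1..n} k. m \<le> card (F \<inter> S)}"

lemma frankl_family_heavy: "frankl_family i t n k = heavy n k (t + i) {1..t + 2 * i}"
  by (simp add: frankl_family_def heavy_def)

lemma ex_permutes_image:
  assumes "finite V" "S \<subseteq> V" "T \<subseteq> V" "card S = card T"
  shows "\<exists>\<pi>. \<pi> permutes V \<and> \<pi> ` S = T"
proof -
  have fin: "finite S" "finite T" using assms finite_subset by auto
  then obtain f where f: "bij_betw f S T" using assms(4) by (metis finite_same_card_bij)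
  have "card (V - S) = card (V - T)" using assms fin by (simp add: card_Diff_subset)
  then obtain g where g: "bij_betw g (V - S) (V - T)"
    using assms(1) by (metis finite_same_card_bij finite_Diff)
  define \<pi> where "\<pi> x = (if x \<in> S then f x else if x \<in> V then g x else x)" for x
  have 1: "bij_betw \<pi> S T" using f by (rule bij_betw_cong[THEN iffD1, rotated]) (simp add: \<pi>_def)
  have 2: "bij_betw \<pi> (V - S) (V - T)" using g by (rule bij_betw_cong[THEN iffD1, rotated]) (simp add: \<pi>_def)
  have "bij_betw \<pi> (S \<union> (V - S)) (T \<union> (V - T))" by (rule bij_betw_combine[OF 1 2]) auto
  then have "bij_betw \<pi> V V" using assms by (simp add: Un_absorb1)
  then have "\<pi> permutes V" by (rule bij_imp_permutes) (use assms in \<open>auto simp: \<pi>_def\<close>)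
  then show ?thesis using 1 by (auto simp: bij_betw_def)
qed

lemma image_heavy:
  assumes \<pi>: "\<pi> permutes {1..n}"
  shows "(`) \<pi> ` heavy n k m S = heavy n k m (\<pi> ` S)"
proof -
  have sub: "(`) \<rho> ` heavy n k m U \<subseteq> heavy n k m (\<rho> ` U)" if \<rho>: "\<rho> permutes {1..n}" for \<rho> U
  proof clarify
    fix F assume "F \<in> heavy n k m U"
    moreover have i: "inj \<rho>" using \<rho> permutes_inj by blast
    moreover have "\<rho> ` F \<inter> \<rho> ` U = \<rho> ` (F \<inter> U)" using i by (simp add: image_Int)
    moreover have "card (\<rho> ` G) = card G" for G using i by (meson card_image inj_on_subset subset_UNIV)
    moreover have "\<rho> ` F \<subseteq> {1..n}" if "F \<subseteq> {1..n}" using that \<rho> permutes_image by blast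
    ultimately show "\<rho> ` F \<in> heavy n k m (\<rho> ` U)" by (auto simp: heavy_def nsets_def)
  qed
  show ?thesis
  proof
    show "heavy n k m (\<pi> ` S) \<subseteq> (`) \<pi> ` heavy n k m S"
    proof
      fix F assume "F \<in> heavy n k m (\<pi> ` S)"
      then have "inv \<pi> ` F \<in> heavy n k m (inv \<pi> ` \<pi> ` S)" using sub[OF permutes_inv[OF \<pi>]] by blast
      moreover have "inv \<pi> ` \<pi> ` S = S" using permutes_inj[OF \<pi>] by (simp add: image_image)
      moreover have "F = \<pi> ` inv \<pi> ` F" using permutes_surj[OF \<pi>] by (simp add: image_f_inv_f)
      ultimately show "F \<in> (`) \<pi> ` heavy n k m S" by auto
    qed
  qed (rule sub[OF \<pi>])
qed

text \<open>A permutation of \<open>{1..n}\<close> acts on a heavy family through its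
  \<open>S\<close>, and any set can be carried to any other of equal size, so isomorphism becomes
  the existence of \<open>S\<close>.\<close>

lemma family_iso_frankl_iff:
  assumes "t + 2 * i \<le> n"
  shows "family_iso n \<A> (frankl_family i t n k) \<longleftrightarrow>
    (\<exists>S\<subseteq>{1..n}. card S = t + 2 * i \<and> \<A> = heavy n k (t + i) S)"
proof
  assume "family_iso n \<A> (frankl_family i t n k)"
  then obtain \<pi> where \<pi>: "\<pi> permutes {1..n}" "frankl_family i t n k = (`) \<pi> ` \<A>"
    by (auto simp: family_iso_def)
  have "(`) (inv \<pi>) ` (`) \<pi> ` \<A> = \<A>"
    using permutes_inj[OF \<pi>(1)] by (simp add: image_image)
  then have "\<A> = heavy n k (t + i) (inv \<pi> ` {1..t + 2 * i})"
    using image_heavy[OF permutes_inv[OF \<pi>(1)]] \<pi>(2) by (metis frankl_family_heavy)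
  moreover have "inv \<pi> ` {1..t + 2 * i} \<subseteq> inv \<pi> ` {1..n}"
    using assms by (intro image_mono) auto
  then have "inv \<pi> ` {1..t + 2 * i} \<subseteq> {1..n}"
    using permutes_image[OF permutes_inv[OF \<pi>(1)]] by blast
  moreover have "card (inv \<pi> ` {1..t + 2 * i}) = t + 2 * i"
    using card_image[OF inj_on_subset[OF permutes_inj[OF permutes_inv[OF \<pi>(1)]] subset_UNIV], of "{1..t + 2 * i}"] by simp
  ultimately show "\<exists>S\<subseteq>{1..n}. card S = t + 2 * i \<and> \<A> = heavy n k (t + i) S" by blast
next
  assume "\<exists>S\<subseteq>{1..n}. card S = t + 2 * i \<and> \<A> = heavy n k (t + i) S"
  then obtain S where S: "S \<subseteq> {1..n}" "card S = t + 2 * i" "\<A> = heavy n k (t + i) S" by blast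
  obtain \<pi> where "\<pi> permutes {1..n}" "\<pi> ` S = {1..t + 2 * i}"
    using ex_permutes_image[of "{1..n}" S "{1..t + 2 * i}"] S assms by auto
  then show "family_iso n \<A> (frankl_family i t n k)"
    using S image_heavy[of \<pi> n k "t + i" S] unfolding family_iso_def frankl_family_heavy by (intro exI[of _ \<pi>]) (simp only:)
qed

lemma Suc_times_choose_Suc: "Suc m * (N choose Suc m) = (N - m) * (N choose m)"
  by (simp only: binomial_absorption binomial_absorb_comp)

lemma card_heavy_0:
  assumes "S \<subseteq> {1..n}" "card S = t" "t \<le> k"
  shows "card (heavy n k t S) = (n - t) choose (k - t)"
proof -
  have fS: "finite S" using finite_subset[OF assms(1)] by simp
  have "heavy n k t S = trace_family n k S {S}"
    using assms fS by (auto simp: heavy_def trace_family_def dest: card_seteq[OF fS Int_lower2])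
  then show ?thesis using card_trace_family_level[of S n "{S}" t k] assms by simp
qed

lemma card_heavy_1:
  assumes "S \<subseteq> {1..n}" "card S = t + 2" "t + 2 \<le> k"
  shows "card (heavy n k (t + 1) S) =
    (t + 2) * ((n - (t + 2)) choose (k - (t + 1))) + ((n - (t + 2)) choose (k - (t + 2)))"
proof -
  have fS: "finite S" using finite_subset[OF assms(1)] by simp
  let ?D = "(\<lambda>c. S - {c}) ` S"
  have "heavy n k (t + 1) S = trace_family n k S (insert S ?D)"
  proof -
    have "t + 1 \<le> card (F \<inter> S) \<longleftrightarrow> F \<inter> S \<in> insert S ?D" for F
    proof
      assume le: "t + 1 \<le> card (F \<inter> S)"
      show "F \<inter> S \<in> insert S ?D"
      proof (cases "S \<subseteq> F")
        case False
        then obtain c where c: "c \<in> S" "c \<notin> F" by auto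
        have "F \<inter> S = S - {c}"
          by (rule card_seteq) (use c le assms fS in \<open>auto simp: card_Diff_singleton_if\<close>)
        then show ?thesis using c by auto
      qed auto
    qed (use assms fS in \<open>auto simp: card_Diff_singleton_if\<close>)
    then show ?thesis by (auto simp: heavy_def trace_family_def)
  qed
  also have "card \<dots> = (\<Sum>X\<in>insert S ?D. (n - card S) choose (k - card X))"
    by (rule card_trace_family) (use assms fS in \<open>auto simp: card_Diff_singleton_if\<close>)
  also have "\<dots> = (n - card S choose (k - card S)) + (\<Sum>X\<in>?D. (n - card S) choose (k - card X))"
    using fS by (subst sum.insert) auto
  also have "(\<Sum>X\<in>?D. (n - card S) choose (k - card X)) = (\<Sum>c\<in>S. (n - card S) choose (k - card (S - {c})))"
    by (subst sum.reindex) (auto simp: inj_on_def)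
  also have "\<dots> = (\<Sum>c\<in>S. (n - (t + 2)) choose (k - (t + 1)))"
    using assms by (intro sum.cong) auto
  finally show ?thesis using assms by simp
qed

text \<open>Over the traces on \<open>t + 2\<close> points, comparing the two Frankl families reduces to
  \<open>t * ((n-t-2) choose (k-t-1))\<close> against \<open>(n-t-2) choose (k-t)\<close>.\<close>

lemma choose_two_step:
  assumes "t + 2 \<le> k" "t + 2 \<le> n"
  shows "(n - t) choose (k - t) = ((n - (t + 2)) choose (k - t)) + 2 * ((n - (t + 2)) choose (k - (t + 1)))
    + ((n - (t + 2)) choose (k - (t + 2)))"
proof -
  define N m where "N = n - (t + 2)" and "m = k - (t + 2)"
  then have N: "n - t = Suc (Suc N)" and m: "k - t = Suc (Suc m)" using assms by auto
  have "n - (t + 2) = N" "k - (t + 1) = Suc m" "k - (t + 2) = m" using N m by auto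
  then show ?thesis using N m by simp
qed

text \<open>With \<open>q = n - (t + 1) * (k - t + 1)\<close>, absorption gives
  \<open>(k - t) * Q = (t * (k - t) + q) * P\<close> for the two binomials, \<open>P\<close> having
  the smaller lower index. The threshold on \<open>n\<close> is exactly where the ratio of
  \<open>Q\<close> to \<open>P\<close> equals \<open>t\<close>.\<close>

lemma choose_ratio_ge:
  assumes "t + 2 \<le> k" "(t + 1) * (k - t + 1) \<le> n"
  shows "t * ((n - (t + 2)) choose (k - (t + 1))) \<le> (n - (t + 2)) choose (k - t)"
    and "t * ((n - (t + 2)) choose (k - (t + 1))) = (n - (t + 2)) choose (k - t) \<longleftrightarrow> n = (t + 1) * (k - t + 1)"
proof -
  define m where "m = k - (t + 2)"
  then have m: "k = t + 2 + m" using assms(1) by simp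
  define q where "q = n - (t + 1) * (m + 3)"
  have "k - t + 1 = m + 3" using m by simp
  then have q: "n = (t + 1) * (m + 3) + q" using assms(2) by (simp only: q_def le_add_diff_inverse)
  let ?P = "(n - (t + 2)) choose Suc m" and ?Q = "(n - (t + 2)) choose Suc (Suc m)"
  have e: "k - (t + 1) = Suc m" "k - t = Suc (Suc m)" using m by auto
  have "Suc (Suc m) * ?Q = (n - (t + 2) - Suc m) * ?P" by (rule Suc_times_choose_Suc)
  moreover have "n - (t + 2) - Suc m = t * Suc (Suc m) + q" using q by (simp add: algebra_simps)
  ultimately have *: "Suc (Suc m) * ?Q = Suc (Suc m) * (t * ?P) + q * ?P"
    by (simp only: distrib_right mult.assoc mult.left_commute)
  have "Suc m \<le> n - (t + 2)" using q by (simp add: algebra_simps)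
  then have P: "?P > 0" by simp
  show "t * ((n - (t + 2)) choose (k - (t + 1))) \<le> (n - (t + 2)) choose (k - t)"
    using * unfolding e by (metis Suc_mult_le_cancel1 le_add1)
  have "t * ?P = ?Q \<longleftrightarrow> Suc (Suc m) * (t * ?P) = Suc (Suc m) * ?Q"
    by (simp only: mult_cancel1) simp
  also have "\<dots> \<longleftrightarrow> q = 0" using * P by simp
  finally have "t * ?P = ?Q \<longleftrightarrow> q = 0" .
  then show "t * ((n - (t + 2)) choose (k - (t + 1))) = (n - (t + 2)) choose (k - t) \<longleftrightarrow> n = (t + 1) * (k - t + 1)"
    unfolding e using q by (simp add: algebra_simps)
qed

text \<open>In the two counting formulas all terms cancel except the two compared in
  \<open>choose_ratio_ge\<close>.\<close>

lemma card_heavy_1_le: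
  assumes "S \<subseteq> {1..n}" "card S = t + 2" "t + 2 \<le> k" "(t + 1) * (k - t + 1) \<le> n"
  shows "card (heavy n k (t + 1) S) \<le> (n - t) choose (k - t)"
    and "card (heavy n k (t + 1) S) = (n - t) choose (k - t) \<longleftrightarrow> n = (t + 1) * (k - t + 1)"
proof -
  have n: "t + 2 \<le> n" using card_mono[OF _ assms(1)] assms(2) by simp
  note c = card_heavy_1[OF assms(1-3)] choose_two_step[OF assms(3) n] choose_ratio_ge[OF assms(3,4)]
  show "card (heavy n k (t + 1) S) \<le> (n - t) choose (k - t)"
    using c(1-3) by (simp only: add_mult_distrib)
  show "card (heavy n k (t + 1) S) = (n - t) choose (k - t) \<longleftrightarrow> n = (t + 1) * (k - t + 1)"
    unfolding c(1,2) c(4)[symmetric] by (auto simp only: add_mult_distrib)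
qed

section \<open>Shifting\<close>

text \<open>The compression replacing \<open>j\<close> by \<open>i\<close>, stated by membership on
  each pair of a set and its swap: the set with \<open>i\<close> is present if either was, the set
  with \<open>j\<close> only if both were. The replacement map itself appears in
  \<open>bij_betw_shift\<close>.\<close>

definition shift :: "nat \<Rightarrow> nat \<Rightarrow> nat set set \<Rightarrow> nat set set" where
  "shift i j \<A> = {F. if i \<in> F \<and> j \<notin> F then F \<in> \<A> \<or> transpose i j ` F \<in> \<A>
    else if j \<in> F \<and> i \<notin> F then F \<in> \<A> \<and> transpose i j ` F \<in> \<A> else F \<in> \<A>}"

definition shifted :: "nat \<Rightarrow> nat set set \<Rightarrow> bool" where
  "shifted n \<A> \<longleftrightarrow> (\<forall>i j. 1 \<le> i \<longrightarrow> i < j \<longrightarrow> j \<le> n \<longrightarrow> shift i j \<A> = \<A>)"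

lemma transpose_image_image [simp]: "transpose i j ` transpose i j ` F = F"
  by (simp add: image_image)

lemma card_transpose_image [simp]: "card (transpose i j ` F) = card F"
  by (simp add: card_image)

lemma card_transpose_image_Int: "card (transpose i j ` F \<inter> transpose i j ` G) = card (F \<inter> G)"
  by (metis card_transpose_image image_Int inj_transpose)

lemma transpose_image_iff [simp]:
  "i \<in> transpose i j ` F \<longleftrightarrow> j \<in> F" "j \<in> transpose i j ` F \<longleftrightarrow> i \<in> F"
  by (simp_all add: in_transpose_image_iff)

lemma transpose_image_eq_insert:
  assumes "j \<in> F" "i \<notin> F"
  shows "transpose i j ` F = insert i (F - {j})"
  using assms by (auto simp: in_transpose_image_iff transpose_def split: if_splits)

lemma transpose_image_eq_insert':
  assumes "i \<in> F" "j \<notin> F"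
  shows "transpose i j ` F = insert j (F - {i})"
  using transpose_image_eq_insert[OF assms] by (simp add: transpose_commute)

lemma transpose_image_nsets:
  assumes "i \<in> V" "j \<in> V"
  shows "transpose i j ` F \<in> nsets V k \<longleftrightarrow> F \<in> nsets V k"
proof -
  have sub: "transpose i j ` F \<subseteq> V" if "F \<subseteq> V" for F
    using that assms by (auto simp: transpose_def)
  have "transpose i j ` F \<subseteq> V \<longleftrightarrow> F \<subseteq> V"
    using sub[of F] sub[of "transpose i j ` F"] by auto
  then show ?thesis by (simp add: nsets_def finite_image_iff)
qed

lemma shift_nsets:
  assumes "i \<in> V" "j \<in> V" "\<A> \<subseteq> nsets V k"
  shows "shift i j \<A> \<subseteq> nsets V k"
proof
  fix F assume "F \<in> shift i j \<A>"
  then have "F \<in> \<A> \<or> transpose i j ` F \<in> \<A>" by (simp add: shift_def split: if_splits; blast)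
  then show "F \<in> nsets V k" using assms(3) transpose_image_nsets[OF assms(1,2), of F k] by blast
qed

text \<open>If \<open>F\<close> is new, its swap lies in \<open>\<A>\<close>. If the swap of
  \<open>G\<close> lies in \<open>\<B>\<close>, compare the two swaps. Otherwise \<open>G\<close>
  contains \<open>i\<close> but not \<open>j\<close>, so the swap of \<open>F\<close> meets
  \<open>G\<close> in fewer points than \<open>F\<close> does.\<close>

lemma shift_cross:
  assumes "cross_intersecting t \<A> \<B>"
  shows "cross_intersecting t (shift i j \<A>) (shift i j \<B>)"
  unfolding cross_intersecting_def
proof (intro ballI)
  fix F G assume F: "F \<in> shift i j \<A>" and G: "G \<in> shift i j \<B>"
  let ?s = "\<lambda>F. transpose i j ` F"
  have c: "t \<le> card (X \<inter> Y)" if "X \<in> \<A>" "Y \<in> \<B>" for X Y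
    using assms that by (auto simp: cross_intersecting_def)
  have sw: "card (?s F \<inter> ?s G) = card (F \<inter> G)" by (rule card_transpose_image_Int)
  consider "F \<in> \<A>" "G \<in> \<B>" | "F \<notin> \<A>" | "G \<notin> \<B>" by blast
  then show "t \<le> card (F \<inter> G)"
  proof cases
    case 1
    then show ?thesis by (rule c)
  next
    case 2
    then have F': "i \<in> F" "j \<notin> F" "?s F \<in> \<A>" using F by (simp_all add: shift_def split: if_splits)
    have eq: "?s F = insert j (F - {i})" by (rule transpose_image_eq_insert') (use F' in auto)
    show ?thesis
    proof (cases "?s G \<in> \<B>")
      case True
      then show ?thesis using c[OF F'(3) True] sw by simp
    next
      case False
      then have G': "G \<in> \<B>" using G by (simp_all add: shift_def split: if_splits)
      have ij: "i \<in> G" "j \<notin> G"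
        using False G G' by (cases "i \<in> G"; cases "j \<in> G"; simp add: shift_def)+
      have "F \<inter> G = insert i (?s F \<inter> G)" using ij F'(1,2) unfolding eq by auto
      then show ?thesis using c[OF F'(3) G'] card_insert_le[of "?s F \<inter> G" i] by simp
    qed
  next
    case 3
    then have G': "i \<in> G" "j \<notin> G" "?s G \<in> \<B>" using G by (simp_all add: shift_def split: if_splits)
    have eq: "?s G = insert j (G - {i})" by (rule transpose_image_eq_insert') (use G' in auto)
    show ?thesis
    proof (cases "?s F \<in> \<A>")
      case True
      then show ?thesis using c[OF True G'(3)] sw by simp
    next
      case False
      then have F': "F \<in> \<A>" using F by (simp_all add: shift_def split: if_splits)
      have ij: "i \<in> F" "j \<notin> F"
        using False F F' by (cases "i \<in> F"; cases "j \<in> F"; simp add: shift_def)+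
      have "F \<inter> G = insert i (F \<inter> ?s G)" using ij G'(1,2) unfolding eq by auto
      then show ?thesis using c[OF F' G'(3)] card_insert_le[of "F \<inter> ?s G" i] by simp
    qed
  qed
qed

lemma bij_betw_shift:
  "bij_betw (\<lambda>F. if j \<in> F \<and> i \<notin> F \<and> transpose i j ` F \<notin> \<A> then transpose i j ` F else F) \<A> (shift i j \<A>)"
proof (rule bij_betw_byWitness[where f' = "\<lambda>F. if i \<in> F \<and> j \<notin> F \<and> F \<notin> \<A> then transpose i j ` F else F"],
    goal_cases)
  case 1
  then show ?case by (intro ballI) simp
next
  case 2
  then show ?case by (intro ballI) (simp add: shift_def split: if_splits; blast)
next
  case 3
  then show ?case by (intro image_subsetI) (auto simp: shift_def)
next
  case 4
  then show ?case by (intro image_subsetI) (simp add: shift_def split: if_splits; blast)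
qed

lemma card_shift: "card (shift i j \<A>) = card \<A>"
  using bij_betw_same_card[OF bij_betw_shift] by metis

text \<open>The sum of all elements is the measure for the induction over successive shifts.\<close>

lemma sum_shift_less:
  assumes "shift i j \<A> \<noteq> \<A>" "finite \<A>" "\<And>F. F \<in> \<A> \<Longrightarrow> finite F" "i < j"
  shows "(\<Sum>F\<in>shift i j \<A>. \<Sum>F) < (\<Sum>F\<in>\<A>. \<Sum>F)"
proof -
  let ?f = "\<lambda>F. if j \<in> F \<and> i \<notin> F \<and> transpose i j ` F \<notin> \<A> then transpose i j ` F else F"
  have less: "\<Sum>(transpose i j ` F) < \<Sum>F" if "F \<in> \<A>" "j \<in> F" "i \<notin> F" for F
  proof -
    have "\<Sum>F = j + \<Sum>(F - {j})" using that assms(3) by (metis sum.remove)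
    moreover have "\<Sum>(insert i (F - {j})) = i + \<Sum>(F - {j})" using that assms(3) by simp
    ultimately show ?thesis using assms(4) that by (simp add: transpose_image_eq_insert)
  qed
  have "\<exists>F\<in>\<A>. ?f F \<noteq> F"
  proof (rule ccontr)
    assume "\<not> ?thesis"
    then have "?f ` \<A> = \<A>" by (simp cong: image_cong)
    then show False using assms(1) bij_betw_imp_surj_on[OF bij_betw_shift, of j i \<A>] by simp
  qed
  then have F: "\<exists>F\<in>\<A>. \<Sum>(?f F) < \<Sum>F" using less by (auto split: if_splits)
  have "(\<Sum>F\<in>shift i j \<A>. \<Sum>F) = (\<Sum>F\<in>\<A>. \<Sum>(?f F))"
    using sum.reindex_bij_betw[OF bij_betw_shift, of "\<lambda>F. \<Sum>F"] by metis
  also have "\<dots> < (\<Sum>F\<in>\<A>. \<Sum>F)"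
  proof (rule sum_strict_mono_ex1)
    show "\<forall>F\<in>\<A>. \<Sum>(?f F) \<le> \<Sum>F" using less by (auto intro: less_imp_le)
  qed (use F assms(2) in blast)+
  finally show ?thesis .
qed

lemma sum_shift_le:
  assumes "finite \<A>" "\<And>F. F \<in> \<A> \<Longrightarrow> finite F" "i < j"
  shows "(\<Sum>F\<in>shift i j \<A>. \<Sum>F) \<le> (\<Sum>F\<in>\<A>. \<Sum>F)"
  using sum_shift_less[of i j \<A>] assms by (cases "shift i j \<A> = \<A>") (simp_all add: less_imp_le)

section \<open>Pulling heavy families back through a single shift\<close>

text \<open>\<open>S - {i}\<close> has \<open>t + 2 * r - 1\<close> points and each of
  \<open>R1\<close>, \<open>R2\<close> misses at most \<open>r\<close> of them. Remove from it
  \<open>r\<close> points common to both and pad outside everything: a given set with exactly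
  \<open>t + r - 1\<close> points in \<open>S\<close> keeps only \<open>t - 1\<close> of them in
  common with the result. Serving two sets at once yields paths of length two in the graph of
  critical sets.\<close>

lemma ex_common_partner:
  assumes S: "S \<subseteq> {1..n}" "card S = t + 2 * r" "i \<in> S" "j \<notin> S" "j \<in> {1..n}"
    and "r + 1 \<le> t" "t + r \<le> k" "t + 2 * r + 3 * k < n"
    and R: "\<And>R. R \<in> {R1, R2} \<Longrightarrow> card R \<le> k \<and> finite R \<and> i \<notin> R \<and> t + r - 1 \<le> card (R \<inter> S)"
  shows "\<exists>R. R \<subseteq> {1..n} - {i, j} \<and> card R = k - 1 \<and> card (R \<inter> S) = t + r - 1 \<and>
    (\<forall>R'\<in>{R1, R2}. card (R' \<inter> S) = t + r - 1 \<longrightarrow> card (R' \<inter> R) < t)"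
proof -
  have fS: "finite S" using finite_subset[OF S(1)] by simp
  let ?S = "S - {i}"
  have cS: "card ?S = t + 2 * r - 1" using S fS by simp
  have miss: "card (?S - R) \<le> r" if "R \<in> {R1, R2}" for R
  proof -
    have "R \<inter> S = ?S \<inter> R" using R[OF that] by auto
    then have "card (?S - R) = card ?S - card (R \<inter> S)"
      using card_Diff_subset_Int[of ?S R] fS by simp
    then show ?thesis using cS R[OF that] by linarith
  qed
  have "card ((?S - R1) \<union> (?S - R2)) \<le> 2 * r"
    using miss[of R1] miss[of R2] card_Un_le[of "?S - R1" "?S - R2"] by simp
  \<comment> \<open>At least \<open>t - 1\<close> points of \<open>S - {i}\<close> lie in both sets,
    and \<open>r + 1 \<le> t\<close> makes that enough.\<close>
  then have "r \<le> card (?S - ((?S - R1) \<union> (?S - R2)))"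
    using diff_card_le_card_Diff[of "(?S - R1) \<union> (?S - R2)" ?S] fS cS assms(6) by simp
  then obtain M where M: "M \<subseteq> ?S - ((?S - R1) \<union> (?S - R2))" "card M = r" "finite M"
    by (rule obtain_subset_with_card_n)
  have "card (insert j (S \<union> R1 \<union> R2)) \<le> 1 + (t + 2 * r + k + k)"
    using card_insert_le_m1[of "1 + (t + 2 * r + k + k)" "S \<union> R1 \<union> R2" j]
      card_Un_le[of "S \<union> R1" R2] card_Un_le[of S R1] S R[of R1] R[of R2] by simp
  then have "k - (t + r) \<le> card ({1..n} - insert j (S \<union> R1 \<union> R2))"
    using diff_card_le_card_Diff[of "insert j (S \<union> R1 \<union> R2)" "{1..n}"] fS R assms(8) by simp
  then obtain Q where Q: "Q \<subseteq> {1..n} - insert j (S \<union> R1 \<union> R2)" "card Q = k - (t + r)" "finite Q"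
    by (rule obtain_subset_with_card_n)
  let ?R = "(?S - M) \<union> Q"
  have cM: "card (?S - M) = t + r - 1"
    using M fS cS by (subst card_Diff_subset) auto
  have "card ?R = card (?S - M) + card Q"
    by (rule card_Un_disjoint) (use Q fS in auto)
  then have 1: "card ?R = k - 1" using cM Q assms(6,7) by simp
  have 2: "?R \<inter> S = ?S - M" using Q S by auto
  have 3: "card (R' \<inter> ?R) < t" if "R' \<in> {R1, R2}" "card (R' \<inter> S) = t + r - 1" for R'
  proof -
    have M': "M \<subseteq> R' \<inter> S" using M that by auto
    have "R' \<inter> ?R = R' \<inter> S - M" using Q R[OF that(1)] that(1) by auto
    then have "card (R' \<inter> ?R) = t - 1"
      using M' M that assms(6) by (simp add: card_Diff_subset)
    then show ?thesis using assms(6) by simp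
  qed
  have 4: "?R \<subseteq> {1..n} - {i, j}" using Q S by auto
  show ?thesis using 1 2 3 4 cM by (intro exI[of _ ?R]) simp
qed

lemma finite_heavy [simp]: "finite (heavy n k m S)"
  by (simp add: heavy_def)

lemma transpose_image_heavy_iff:
  assumes "i \<in> {1..n}" "j \<in> {1..n}"
  shows "transpose i j ` F \<in> heavy n k m S \<longleftrightarrow> F \<in> heavy n k m (transpose i j ` S)"
  using transpose_image_nsets[OF assms, of F k] card_transpose_image_Int[of i j F "transpose i j ` S"]
  by (simp add: heavy_def)

lemma card_heavy_transpose:
  assumes "i \<in> {1..n}" "j \<in> {1..n}"
  shows "card (heavy n k m (transpose i j ` S)) = card (heavy n k m S)"
proof -
  have "(`) (transpose i j) ` heavy n k m S = heavy n k m (transpose i j ` S)"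
    by (rule image_heavy[OF permutes_swap_id[OF assms]])
  moreover have "inj_on ((`) (transpose i j)) (heavy n k m S)"
    by (rule inj_on_inverseI[where g = "(`) (transpose i j)"]) simp
  ultimately show ?thesis using card_image by fastforce
qed

context
  fixes n k t r i j :: nat and S :: "nat set"
  assumes ij: "i \<in> {1..n}" "j \<in> {1..n}"
    and S: "S \<subseteq> {1..n}" "card S = t + 2 * r"
    and bounds: "r + 1 \<le> t" "t + 2 * r \<le> k" "t + 2 * r + 3 * k < n"
begin

text \<open>The swap fixes \<open>S\<close>, so the heavy family is closed under it and contains
  \<open>\<A>\<close>; equality follows because shifting preserves cardinality.\<close>

lemma unshift_heavy_sym:
  assumes \<A>: "shift i j \<A> = heavy n k (t + r) S" and "i \<in> S \<longleftrightarrow> j \<in> S"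
  shows "\<A> = heavy n k (t + r) S"
proof (rule card_seteq)
  have sym: "transpose i j ` S = S" using assms(2) by simp
  show "\<A> \<subseteq> heavy n k (t + r) S"
  proof
    fix F assume F: "F \<in> \<A>"
    show "F \<in> heavy n k (t + r) S"
    proof (cases "j \<in> F \<and> i \<notin> F")
      case True
      then have "transpose i j ` F \<in> shift i j \<A>" using F by (simp add: shift_def)
      then show ?thesis using \<A> transpose_image_heavy_iff[OF ij, of F k "t + r" S] sym by simp
    next
      case False
      then have "F \<in> shift i j \<A>" using F by (auto simp: shift_def)
      then show ?thesis using \<A> by simp
    qed
  qed
qed (simp, simp add: \<A>[symmetric] card_shift)

text \<open>A shifted family is closed under replacing \<open>j\<close> by \<open>i\<close>, but a
  set with exactly \<open>t + r\<close> points in \<open>S\<close>, among them \<open>j\<close>,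
  leaves the heavy family under this replacement.\<close>

lemma not_shift_eq_heavy:
  assumes \<A>: "shift i j \<A> = heavy n k (t + r) S" and "i \<notin> S" "j \<in> S"
  shows False
proof -
  have fS: "finite S" using finite_subset[OF S(1)] by simp
  \<comment> \<open>Only the existence of a suitable \<open>R\<close> matters here, so
    \<open>S - {j}\<close> fills both slots; \<open>i\<close> and \<open>j\<close> trade places
    because \<open>j\<close> is now the point of \<open>S\<close>.\<close>
  have "card (S - {j}) = t + 2 * r - 1" "(S - {j}) \<inter> S = S - {j}" using S fS assms by auto
  then have "\<exists>R. R \<subseteq> {1..n} - {j, i} \<and> card R = k - 1 \<and> card (R \<inter> S) = t + r - 1 \<and>
    (\<forall>R'\<in>{S - {j}, S - {j}}. card (R' \<inter> S) = t + r - 1 \<longrightarrow> card (R' \<inter> R) < t)"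
    by (intro ex_common_partner) (use S ij assms bounds fS in auto)
  then obtain R where R: "R \<subseteq> {1..n} - {j, i}" "card R = k - 1" "card (R \<inter> S) = t + r - 1" by blast
  have fR: "finite R" using finite_subset[OF R(1)] by simp
  have jR: "insert j R \<inter> S = insert j (R \<inter> S)" and iR: "insert i R \<inter> S = R \<inter> S" using assms by auto
  have nR: "i \<notin> R" "j \<notin> R" "R \<subseteq> {1..n}" using R by auto
  have "card (insert j (R \<inter> S)) = t + r" using R fR nR bounds by simp
  then have "insert j R \<in> heavy n k (t + r) S"
    using R(2) fR nR ij bounds jR by (simp add: heavy_def nsets_def)
  then have "insert j R \<in> shift i j \<A>" using \<A> by simp
  moreover have ne: "i \<noteq> j" using assms by auto
  ultimately have 1: "insert j R \<in> \<A>" using nR by (simp add: shift_def)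
  have "transpose i j ` insert i R = insert j (insert i R - {i})"
    by (rule transpose_image_eq_insert') (use nR ne in auto)
  then have "transpose i j ` insert i R = insert j R" using nR by simp
  then have "insert i R \<in> shift i j \<A>" using 1 nR ne by (simp add: shift_def)
  then have "insert i R \<in> heavy n k (t + r) S" using \<A> by simp
  then have "t + r \<le> card (insert i R \<inter> S)" by (simp add: heavy_def)
  moreover have "card (insert i R \<inter> S) = t + r - 1" using R(3) iR by simp
  ultimately show False using bounds(1) by linarith
qed

text \<open>For these \<open>R\<close> exactly one of \<open>R \<union> {i}\<close> and \<open>R \<union> {j}\<close> lies in a preimage of the heavy family.\<close>

definition critical :: "nat set set" where
  "critical = {R. R \<subseteq> {1..n} - {i, j} \<and> card R = k - 1 \<and> card (R \<inter> S) = t + r - 1}"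

text \<open>A preimage is determined by one binary choice per critical set; if all choices agree, it
  is one of two heavy families. Only inclusion needs an argument, since the cardinalities
  agree.\<close>

lemma unshift_heavy_asym:
  assumes iS: "i \<in> S" "j \<notin> S" and X: "X \<subseteq> nsets {1..n} k" "shift i j X = heavy n k (t + r) S"
  shows "R \<in> critical \<Longrightarrow> insert j R \<in> X \<longleftrightarrow> insert i R \<notin> X"
    and "(\<And>R. R \<in> critical \<Longrightarrow> insert i R \<in> X) \<Longrightarrow> X = heavy n k (t + r) S"
    and "(\<And>R. R \<in> critical \<Longrightarrow> insert i R \<notin> X) \<Longrightarrow> X = heavy n k (t + r) (transpose i j ` S)"
proof -
  have ne: "i \<noteq> j" using iS by auto
  have fS: "finite S" using finite_subset[OF S(1)] by simp
  have split: "insert i R \<inter> S = insert i (R \<inter> S)" "insert j R \<inter> S = R \<inter> S" for R using iS by auto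
  have swap: "transpose i j ` insert i R = insert j R" "transpose i j ` insert j R = insert i R"
    if "i \<notin> R" "j \<notin> R" for R
    using that ne transpose_image_eq_insert'[of i "insert i R" j] transpose_image_eq_insert[of j "insert j R" i]
    by auto
  show 1: "insert j R \<in> X \<longleftrightarrow> insert i R \<notin> X" if "R \<in> critical" for R
  proof -
    have R: "R \<subseteq> {1..n}" "i \<notin> R" "j \<notin> R" "card R = k - 1" "card (R \<inter> S) = t + r - 1"
      using that by (auto simp: critical_def)
    have fR: "finite R" using finite_subset[OF R(1)] by simp
    have "insert i R \<in> heavy n k (t + r) S"
      using R fR ij bounds split by (simp add: heavy_def nsets_def)
    then have "insert i R \<in> X \<or> insert j R \<in> X"
      using X(2)[symmetric] R ne swap[of R] by (simp add: shift_def)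
    moreover have "card (insert j R \<inter> S) = t + r - 1" using R(5) split by simp
    then have "\<not> t + r \<le> card (insert j R \<inter> S)" using bounds(1) by linarith
    then have "insert j R \<notin> heavy n k (t + r) S" by (simp add: heavy_def)
    then have "\<not> (insert i R \<in> X \<and> insert j R \<in> X)"
      using X(2)[symmetric] R ne swap[of R] by (auto simp: shift_def)
    ultimately show ?thesis by blast
  qed
  \<comment> \<open>Without its point \<open>c\<close>, a set either is critical or still has
    \<open>t + r\<close> points in \<open>S\<close>; in the latter case it is heavy whatever the
    choices are.\<close>
  have crit: "F - {c} \<in> critical \<or> t + r \<le> card ((F - {c}) \<inter> S)"
    if F: "F \<in> X" "c \<in> F" "c \<in> {i, j}" "{i, j} \<inter> F = {c}" "insert i (F - {c}) \<in> heavy n k (t + r) S" for F c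
  proof -
    have F': "F \<subseteq> {1..n}" "card F = k" "finite F" using F(1) X by (auto simp: nsets_def)
    have "F - {c} \<subseteq> {1..n} - {i, j}" using F' F by auto
    moreover have "card (F - {c}) = k - 1" using F' F by simp
    moreover have "t + r \<le> card (insert i ((F - {c}) \<inter> S))"
      using F(5) split(1)[of "F - {c}"] by (simp add: heavy_def)
    then have "t + r \<le> Suc (card ((F - {c}) \<inter> S))"
      using fS card_insert_if[of "(F - {c}) \<inter> S" i] by (auto split: if_splits)
    then have "card ((F - {c}) \<inter> S) = t + r - 1 \<or> t + r \<le> card ((F - {c}) \<inter> S)" by linarith
    ultimately show ?thesis unfolding critical_def by auto
  qed
  have H: "F \<in> heavy n k (t + r) S" if "t + r \<le> card ((F - {c}) \<inter> S)" "F \<in> nsets {1..n} k" for F c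
    using that card_mono[of "F \<inter> S" "(F - {c}) \<inter> S"] fS by (force simp: heavy_def)
  show "X = heavy n k (t + r) S" if all: "\<And>R. R \<in> critical \<Longrightarrow> insert i R \<in> X"
  proof (rule card_seteq)
    show "X \<subseteq> heavy n k (t + r) S"
    proof
      fix F assume F: "F \<in> X"
      show "F \<in> heavy n k (t + r) S"
      proof (cases "j \<in> F \<and> i \<notin> F")
        case True
        have sF: "transpose i j ` F = insert i (F - {j})" using True by (simp add: transpose_image_eq_insert)
        show ?thesis
        proof (cases "insert i (F - {j}) \<in> X")
          case True': True
          then have "F \<in> shift i j X" using F True sF by (simp add: shift_def)
          then show ?thesis using X by simp
        next
          case False
          have "transpose i j ` F \<in> shift i j X" using F True by (simp add: shift_def)
          then have "insert i (F - {j}) \<in> heavy n k (t + r) S" using X sF by simp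
          then have "F - {j} \<in> critical \<or> t + r \<le> card ((F - {j}) \<inter> S)"
            by (intro crit) (use F True in auto)
          then show ?thesis using all False H F X by blast
        qed
      next
        case False
        then have "F \<in> shift i j X" using F by (auto simp: shift_def)
        then show ?thesis using X by simp
      qed
    qed
  qed (simp, simp add: X(2)[symmetric] card_shift)
  show "X = heavy n k (t + r) (transpose i j ` S)" if none: "\<And>R. R \<in> critical \<Longrightarrow> insert i R \<notin> X"
  proof (rule card_seteq)
    show "X \<subseteq> heavy n k (t + r) (transpose i j ` S)"
    proof
      fix F assume F: "F \<in> X"
      have "transpose i j ` F \<in> heavy n k (t + r) S"
      proof (cases "i \<in> F \<and> j \<notin> F")
        case True
        have "F \<in> shift i j X" using F True by (simp add: shift_def)
        then have "insert i (F - {i}) \<in> heavy n k (t + r) S" using X True by (simp add: insert_absorb)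
        then have "F - {i} \<in> critical \<or> t + r \<le> card ((F - {i}) \<inter> S)"
          by (intro crit) (use F True in auto)
        then have le: "t + r \<le> card ((F - {i}) \<inter> S)" using none[of "F - {i}"] F True by (auto simp: insert_absorb)
        have "transpose i j ` F - {j} = F - {i}" using True by (simp add: transpose_image_eq_insert')
        then show ?thesis using H[of "transpose i j ` F" j] le transpose_image_nsets[OF ij, of F k] F X by auto
      next
        case False
        then have "transpose i j ` F \<in> shift i j X"
          using F by (cases "i \<in> F"; cases "j \<in> F"; simp add: shift_def)
        then show ?thesis using X by simp
      qed
      then show "F \<in> heavy n k (t + r) (transpose i j ` S)" using transpose_image_heavy_iff[OF ij] by blast
    qed
  qed (simp, simp add: card_heavy_transpose[OF ij] X(2)[symmetric] card_shift)
qed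

text \<open>Each critical set makes a choice in \<open>\<A>\<close> and one in \<open>\<B>\<close>.
  Critical sets meeting in fewer than \<open>t\<close> points must choose alike across the two
  families, and common partners spread this to all of them.\<close>

lemma unshift_heavy:
  assumes AB: "\<A> \<subseteq> nsets {1..n} k" "\<B> \<subseteq> nsets {1..n} k" "cross_intersecting t \<A> \<B>"
    and sh: "shift i j \<A> = heavy n k (t + r) S" "shift i j \<B> = heavy n k (t + r) S"
  shows "\<exists>S'\<subseteq>{1..n}. card S' = t + 2 * r \<and> \<A> = heavy n k (t + r) S' \<and> \<B> = heavy n k (t + r) S'"
proof (cases "i \<in> S \<and> j \<notin> S")
  case False
  then have "i \<in> S \<longleftrightarrow> j \<in> S" using not_shift_eq_heavy[OF sh(1)] by blast
  then show ?thesis using S sh unshift_heavy_sym by blast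
next
  case iS: True
  note asymA = unshift_heavy_asym[OF conjunct1[OF iS] conjunct2[OF iS] AB(1) sh(1)]
  note asymB = unshift_heavy_asym[OF conjunct1[OF iS] conjunct2[OF iS] AB(2) sh(2)]
  \<comment> \<open>Adding \<open>i\<close> to one set and \<open>j\<close> to the other creates no
    common point, so opposite choices would leave fewer than \<open>t\<close> points in
    common.\<close>
  have edge: "insert i R \<in> \<A> \<longleftrightarrow> insert i R' \<in> \<B>"
    if R: "R \<in> critical" "R' \<in> critical" "card (R \<inter> R') < t" for R R'
  proof -
    have "insert i R \<inter> insert j R' = R \<inter> R'" "insert j R \<inter> insert i R' = R \<inter> R'"
      using R iS by (auto simp: critical_def)
    then have "\<not> (insert i R \<in> \<A> \<and> insert j R' \<in> \<B>)" "\<not> (insert j R \<in> \<A> \<and> insert i R' \<in> \<B>)"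
      using AB(3) R(3) unfolding cross_intersecting_def by (metis not_le)+
    then show ?thesis using asymA(1) asymB(1) R by blast
  qed
  have partner: "\<exists>R\<in>critical. card (R1 \<inter> R) < t \<and> card (R2 \<inter> R) < t"
    if R: "R1 \<in> critical" "R2 \<in> critical" for R1 R2
  proof -
    have "finite R1" "finite R2" using R finite_subset[of _ "{1..n} - {i, j}"] by (auto simp: critical_def)
    then have "\<exists>R. R \<subseteq> {1..n} - {i, j} \<and> card R = k - 1 \<and> card (R \<inter> S) = t + r - 1 \<and>
      (\<forall>R'\<in>{R1, R2}. card (R' \<inter> S) = t + r - 1 \<longrightarrow> card (R' \<inter> R) < t)"
      by (intro ex_common_partner) (use S ij iS bounds R in \<open>auto simp: critical_def\<close>)
    then show ?thesis using R by (auto simp: critical_def)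
  qed
  have constA: "insert i R1 \<in> \<A> \<longleftrightarrow> insert i R2 \<in> \<A>" if "R1 \<in> critical" "R2 \<in> critical" for R1 R2
    using partner[OF that] edge that by blast
  have constB: "insert i R1 \<in> \<A> \<longleftrightarrow> insert i R2 \<in> \<B>" if R: "R1 \<in> critical" "R2 \<in> critical" for R1 R2
  proof -
    obtain R where "R \<in> critical" "card (R \<inter> R2) < t"
      using partner[OF R(2) R(2)] by (metis Int_commute)
    then show ?thesis using edge[of R R2] constA[of R R1] R by blast
  qed
  show ?thesis
  proof (cases "\<exists>R\<in>critical. insert i R \<in> \<A>")
    case True
    then have "\<A> = heavy n k (t + r) S" "\<B> = heavy n k (t + r) S"
      using constA constB by (intro asymA(2) asymB(2); blast)+
    then show ?thesis using S by blast
  next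
    case False
    then have "\<A> = heavy n k (t + r) (transpose i j ` S)" "\<B> = heavy n k (t + r) (transpose i j ` S)"
      using constB by (intro asymA(3) asymB(3); blast)+
    moreover have "transpose i j ` S \<subseteq> {1..n}" using S ij by (auto simp: transpose_def)
    ultimately show ?thesis using S by (intro exI[of _ "transpose i j ` S"]) simp
  qed
qed

end

section \<open>Generators of an optimal shifted pair\<close>

text \<open>Here \<open>t + e + s\<close> is \<open>l\<close>, and \<open>t + e\<close>,
  \<open>t + s\<close> are the two trace sizes. The estimates end in
  \<open>(u - 1) * (u - 2) \<le> u + 4\<close>, which fails from \<open>u = 5\<close> on but not at
  4; hence \<open>5 \<le> t\<close>.\<close>

lemma critical_weights_contradiction:
  fixes x y :: real and t e s :: nat
  assumes "5 \<le> t" "1 \<le> s" "2 \<le> e" "s \<le> e" "0 < x" "0 < y"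
    and x: "real (t + e + s) * x \<le> real (t + e)" and y: "real (t + e + s) * y \<le> real (t + s)"
    and xy: "real t * x * (1 - y) \<le> y" and yx: "(real t - 1) * y * (1 - x) \<le> x"
  shows False
proof -
  define u where "u = real t"
  define p where "p = real e"
  define q where "q = real s"
  have h: "5 \<le> u" "1 \<le> q" "2 \<le> p" "q \<le> p" using assms by (auto simp: u_def p_def q_def)
  have x': "(u + p + q) * x \<le> u + p" and y': "(u + p + q) * y \<le> u + q"
    and xy': "u * x * (1 - y) \<le> y" and yx': "(u - 1) * y * (1 - x) \<le> x"
    using x y xy yx by (simp_all add: u_def p_def q_def)
  have "y < 1"
  proof (rule ccontr)
    assume "\<not> y < 1"
    then have "(u + p + q) * 1 \<le> (u + p + q) * y" using h by (intro mult_left_mono) auto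
    also have "\<dots> \<le> u + q" by (rule y')
    finally show False using h by simp
  qed
  \<comment> \<open>The level bound says \<open>p * y \<le> (u + q) * (1 - y)\<close>, which
    eliminates \<open>y\<close> from the first exchange.\<close>
  have "u * x * p * (1 - y) \<le> p * y" using mult_left_mono[OF xy', of p] h by (simp add: algebra_simps)
  also have "p * y \<le> (u + q) * (1 - y)" using y' by (simp add: algebra_simps)
  finally have 1: "u * x * p \<le> u + q" using \<open>y < 1\<close> by simp
  \<comment> \<open>Equality holds at \<open>p = q = 2\<close>; as \<open>e\<close> is an integer,
    the other case starts at 3 and has slack.\<close>
  have "2 * (u + q) \<le> p * (u + 2)"
  proof (cases "p < 3")
    case True
    then have "e = 2" using assms(3) by (simp add: p_def)
    then have "p = 2" by (simp add: p_def)
    then show ?thesis using h by (simp add: algebra_simps)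
  next
    case False
    then have "3 * u \<le> p * u" using h by (intro mult_right_mono) auto
    moreover have "2 * (u + q) \<le> 3 * u + 2 * p" using h by simp
    ultimately have "2 * (u + q) \<le> p * u + 2 * p" by simp
    then show ?thesis by (simp add: algebra_simps)
  qed
  then have "p * (2 * (u * x)) \<le> p * (u + 2)" using 1 by (simp add: algebra_simps)
  then have 2: "2 * (u * x) \<le> u + 2" using h by simp
  then have 3: "u - 2 \<le> 2 * u * (1 - x)" by (simp add: algebra_simps)
  have "((u - 1) * y) * (u - 2) \<le> ((u - 1) * y) * (2 * u * (1 - x))"
    by (rule mult_left_mono[OF 3]) (use h assms in auto)
  also have "\<dots> = 2 * u * ((u - 1) * y * (1 - x))" by (simp add: algebra_simps)
  also have "\<dots> \<le> 2 * u * x" using mult_left_mono[OF yx', of "2 * u"] h by simp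
  also have "\<dots> \<le> u + 2" using 2 by simp
  finally have 4: "(u - 1) * (u - 2) * y \<le> u + 2" by (simp add: algebra_simps)
  have "x < 1"
  proof (rule ccontr)
    assume "\<not> x < 1"
    then have "u * 1 \<le> u * x" using h by (intro mult_left_mono) auto
    then show False using 2 h by linarith
  qed
  \<comment> \<open>Chaining the two exchanges cancels both fractions and bounds
    \<open>(1 - x) * (1 - y)\<close> alone.\<close>
  have "(u - 1) * (1 - x) * (u * x * (1 - y)) \<le> (u - 1) * (1 - x) * y"
    by (rule mult_left_mono[OF xy']) (use h \<open>x < 1\<close> in auto)
  also have "\<dots> \<le> x" using yx' by (simp add: algebra_simps)
  finally have "x * ((u - 1) * (1 - x) * u * (1 - y)) \<le> x * 1" by (simp add: algebra_simps)
  then have 5: "(u - 1) * (1 - x) * u * (1 - y) \<le> 1" using assms(5) by (rule mult_left_le_imp_le)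
  have "((u - 1) * (1 - y)) * (u - 2) \<le> ((u - 1) * (1 - y)) * (2 * u * (1 - x))"
    by (rule mult_left_mono[OF 3]) (use h \<open>y < 1\<close> in auto)
  also have "\<dots> = 2 * ((u - 1) * (1 - x) * u * (1 - y))" by (simp add: algebra_simps)
  finally have "(u - 1) * (u - 2) - (u - 1) * (u - 2) * y \<le> 2" using 5 by (simp add: algebra_simps)
  then have "(u - 1) * (u - 2) \<le> u + 4" using 4 by linarith
  moreover have "u * 5 \<le> u * u" using h by (intro mult_left_mono) auto
  ultimately show False using h by (simp add: algebra_simps)
qed

section \<open>Optimal pairs and their generators on an initial segment\<close>

definition optimal_pair :: "nat \<Rightarrow> nat \<Rightarrow> nat \<Rightarrow> nat set set \<Rightarrow> nat set set \<Rightarrow> bool" where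
  "optimal_pair n k t \<A> \<B> \<longleftrightarrow> \<A> \<subseteq> nsets {1..n} k \<and> \<B> \<subseteq> nsets {1..n} k \<and> cross_intersecting t \<A> \<B> \<and>
    (\<forall>\<A>' \<B>'. \<A>' \<subseteq> nsets {1..n} k \<longrightarrow> \<B>' \<subseteq> nsets {1..n} k \<longrightarrow> cross_intersecting t \<A>' \<B>' \<longrightarrow>
      card \<A>' * card \<B>' \<le> card \<A> * card \<B>)"

text \<open>All supersets are required to lie in \<open>\<A>\<close>, not just the sets with this
  exact trace, which gives closure under supersets. The bound \<open>card X \<le> k\<close> excludes
  sets that would qualify vacuously.\<close>

definition gens :: "nat \<Rightarrow> nat \<Rightarrow> nat \<Rightarrow> nat set set \<Rightarrow> nat set set" where
  "gens n k l \<A> = {X. X \<subseteq> {1..l} \<and> card X \<le> k \<and> (\<forall>F\<in>nsets {1..n} k. X \<subseteq> F \<longrightarrow> F \<in> \<A>)}"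

text \<open>The generators for which \<open>l\<close> is essential. If neither family has one, the
  traces on \<open>[l - 1]\<close> already decide membership.\<close>

definition star :: "nat \<Rightarrow> nat \<Rightarrow> nat \<Rightarrow> nat set set \<Rightarrow> nat set set" where
  "star n k l \<A> = {X \<in> gens n k l \<A>. l \<in> X \<and> X - {l} \<notin> gens n k l \<A>}"

lemma cross_intersecting_commute: "cross_intersecting t \<A> \<B> \<longleftrightarrow> cross_intersecting t \<B> \<A>"
  unfolding cross_intersecting_def by (metis Int_commute)

lemma optimal_pair_commute:
  assumes "optimal_pair n k t \<A> \<B>"
  shows "optimal_pair n k t \<B> \<A>"
  using assms unfolding optimal_pair_def
  by (auto simp: mult.commute[of "card \<B>"] intro: cross_intersecting_commute[THEN iffD1]
      dest: cross_intersecting_commute[THEN iffD1])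

lemma shiftedD:
  assumes "shifted n \<A>" "F \<in> \<A>" "j \<in> F" "i \<notin> F" "1 \<le> i" "i < j" "j \<le> n"
  shows "insert i (F - {j}) \<in> \<A>"
proof -
  have "F \<in> shift i j \<A>" using assms by (simp add: shifted_def)
  then show ?thesis using assms(3,4) transpose_image_eq_insert[OF assms(3,4)] by (simp add: shift_def)
qed

lemma finite_gens [simp]: "finite (gens n k l \<A>)"
  by (rule finite_subset[of _ "Pow {1..l}"]) (auto simp: gens_def)

lemma finite_star [simp]: "finite (star n k l \<A>)"
  by (simp add: star_def)

lemma gensD:
  assumes "X \<in> gens n k l \<A>"
  shows "X \<subseteq> {1..l}" "card X \<le> k" "finite X"
  using assms finite_subset[of X "{1..l}"] by (auto simp: gens_def)

lemma starD:
  assumes "X \<in> star n k l \<A>"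
  shows "X \<in> gens n k l \<A>" "l \<in> X" "X \<subseteq> {1..l}" "finite X" "card X \<le> k"
  using assms gensD[of X n k l \<A>] by (auto simp: star_def)

lemma gens_mono:
  assumes "X \<in> gens n k l \<A>" "X \<subseteq> Y" "Y \<subseteq> {1..l}" "card Y \<le> k"
  shows "Y \<in> gens n k l \<A>"
  using assms by (auto simp: gens_def)

text \<open>If \<open>F\<close> contains the new set but not \<open>j\<close>, putting
  \<open>j\<close> back in place of \<open>i\<close> gives a superset of \<open>X\<close>, hence a
  member of \<open>\<A>\<close>, and shiftedness returns \<open>F\<close>.\<close>

lemma gens_shift:
  assumes "X \<in> gens n k l \<A>" "shifted n \<A>" "l \<le> n" "j \<in> X" "i \<notin> X" "1 \<le> i" "i < j"
  shows "insert i (X - {j}) \<in> gens n k l \<A>"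
proof -
  note X = gensD[OF assms(1)]
  have j: "j \<le> l" using X assms by auto
  have "F \<in> \<A>" if F: "F \<in> nsets {1..n} k" "insert i (X - {j}) \<subseteq> F" for F
  proof (cases "j \<in> F")
    case True
    then show ?thesis using F assms by (auto simp: gens_def)
  next
    case False
    have "i \<in> F" using F by auto
    then have "insert j (F - {i}) = transpose i j ` F"
      using False by (simp add: transpose_image_eq_insert')
    then have "insert j (F - {i}) \<in> nsets {1..n} k"
      using F j assms transpose_image_nsets[of i "{1..n}" j F k] by simp
    moreover have "X \<subseteq> insert j (F - {i})" using F assms by auto
    ultimately have "insert j (F - {i}) \<in> \<A>" using assms(1) by (auto simp: gens_def)
    then have "insert i (insert j (F - {i}) - {j}) \<in> \<A>"
      by (rule shiftedD[OF assms(2)]) (use assms j in auto)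
    moreover have "insert i (insert j (F - {i}) - {j}) = F" using False \<open>i \<in> F\<close> by auto
    ultimately show ?thesis by simp
  qed
  moreover have "insert i (X - {j}) \<subseteq> {1..l}" using X j assms by auto
  moreover have "card (insert i (X - {j})) = card X"
    using card_transpose_image[of i j X] transpose_image_eq_insert[of j X i] assms by simp
  ultimately show ?thesis using X by (auto simp: gens_def)
qed

text \<open>Two generators can be padded to \<open>k\<close>-sets by disjoint sets outside their
  union, which takes at most \<open>2 * k\<close> points in all; the padded sets meet only in
  \<open>X \<inter> Y\<close>.\<close>

lemma gens_cross:
  assumes X: "X \<in> gens n k l \<A>" and Y: "Y \<in> gens n k l \<B>" and "cross_intersecting t \<A> \<B>" "l \<le> n" "2 * k \<le> n"
  shows "t \<le> card (X \<inter> Y)"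
proof -
  note X' = gensD[OF X] and Y' = gensD[OF Y]
  have cu: "card (X \<union> Y) \<le> card X + card Y" by (rule card_Un_le)
  have sub: "X \<union> Y \<subseteq> {1..n}" using X' Y' assms(4) by fastforce
  have "k - card X \<le> card ({1..n} - (X \<union> Y))"
    using sub X' Y' cu assms(5) by (simp add: card_Diff_subset)
  then obtain U where U: "U \<subseteq> {1..n} - (X \<union> Y)" "card U = k - card X" "finite U"
    by (rule obtain_subset_with_card_n)
  have "card (X \<union> Y \<union> U) \<le> card X + card Y + (k - card X)"
    using card_Un_le[of "X \<union> Y" U] cu U by simp
  then have "k - card Y \<le> card ({1..n} - (X \<union> Y \<union> U))"
    using sub X' Y' U assms(5) by (subst card_Diff_subset) auto
  then obtain W where W: "W \<subseteq> {1..n} - (X \<union> Y \<union> U)" "card W = k - card Y" "finite W"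
    by (rule obtain_subset_with_card_n)
  have "card (X \<union> U) = card X + card U" "card (Y \<union> W) = card Y + card W"
    by (rule card_Un_disjoint; use X' Y' U W in auto)+
  then have "X \<union> U \<in> nsets {1..n} k" "Y \<union> W \<in> nsets {1..n} k"
    using U W X' Y' sub by (auto simp: nsets_def)
  then have "X \<union> U \<in> \<A>" "Y \<union> W \<in> \<B>" using X Y by (auto simp: gens_def)
  then have "t \<le> card ((X \<union> U) \<inter> (Y \<union> W))" using assms(3) by (auto simp: cross_intersecting_def)
  moreover have "(X \<union> U) \<inter> (Y \<union> W) = X \<inter> Y" using U W by auto
  ultimately show ?thesis by simp
qed

lemma trace_family_gens:
  assumes "\<X> \<subseteq> gens n k l \<A>"
  shows "trace_family n k {1..l} \<X> \<subseteq> \<A>"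
  using assms by (fastforce simp: trace_family_def gens_def)

text \<open>The left side does not increase with \<open>l\<close>. Strictness comes from
  \<open>l = t + 1\<close>, where absorption reduces it to
  \<open>(t + 1) * (k - t) < n - t\<close>.\<close>

lemma choose_mult_choose_less:
  assumes n: "(t + 1) * (k - t + 1) \<le> n" and "t < l" "l \<le> k"
  shows "(l choose t) * ((n - l) choose (k - l)) < (n - t) choose (k - t)"
proof -
  have "Suc t \<le> l" using assms by simp
  then show ?thesis
  proof (induction rule: dec_induct)
    case base
    define m where "m = k - Suc t"
    have k: "k - t = Suc m" using assms by (simp add: m_def)
    have nt: "(t + 1) * Suc m < n - t" using n k by (simp add: algebra_simps)
    define C where "C = (n - Suc t) choose m"
    have "m \<le> (t + 1) * Suc m" by simp
    then have "m \<le> n - Suc t" using nt by linarith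
    then have C: "0 < C" by (simp add: C_def)
    have "n - t - 1 = n - Suc t" by simp
    then have "Suc m * ((n - t) choose Suc m) = (n - t) * C"
      using binomial_absorption[of m "n - t"] by (simp only: C_def)
    also have "\<dots> > ((t + 1) * Suc m) * C" using nt C by (rule mult_less_mono1)
    finally have "Suc m * ((t + 1) * C) < Suc m * ((n - t) choose Suc m)" by (simp only: ac_simps)
    then have "(t + 1) * C < (n - t) choose Suc m" by (simp only: Suc_mult_less_cancel1)
    moreover have "Suc t choose t = t + 1" using binomial_symmetric[of t "Suc t"] by simp
    ultimately show ?case unfolding k C_def m_def by simp
  next
    case (step j)
    define d where "d = j - Suc t"
    define m where "m = k - Suc j"
    have j: "j = Suc t + d" using step by (simp add: d_def)
    have "j < k" using step assms by simp
    then have k: "k = Suc j + m" "k - j = Suc m" "k - Suc j = m" by (simp_all add: m_def)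
    define C where "C = (n - Suc j) choose m"
    have "k - t + 1 = d + m + 3" using k(1) j by simp
    then have n': "(t + 1) * (d + m + 3) \<le> n" using n by (simp only:)
    have c1: "(Suc d + 1) * (Suc j choose t) = Suc j * (j choose t)"
      using binomial_absorb_comp[of "Suc j" t] j by simp
    have "n - j - 1 = n - Suc j" by simp
    then have c2: "Suc m * ((n - j) choose Suc m) = (n - j) * C"
      using binomial_absorption[of m "n - j"] by (simp only: C_def)
    have "(t + 2 + d) * Suc m \<le> ((d + 2) * (t + 1)) * Suc m" by (rule mult_le_mono1) simp
    also have "\<dots> = (d + 2) * ((t + 1) * Suc m)" by (simp only: mult.assoc)
    also have "\<dots> \<le> (d + 2) * (n - j)"
      by (rule mult_le_mono2) (use n' j in \<open>simp add: algebra_simps\<close>)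
    finally have le: "Suc j * Suc m \<le> (d + 2) * (n - j)" using j by simp
    have "(Suc j * Suc m) * ((Suc j choose t) * C) \<le> ((d + 2) * (n - j)) * ((Suc j choose t) * C)"
      using le by (rule mult_le_mono1)
    also have "\<dots> = ((Suc d + 1) * (Suc j choose t)) * ((n - j) * C)" by (simp only: ac_simps) simp
    also have "\<dots> = (Suc j * Suc m) * ((j choose t) * ((n - j) choose Suc m))"
      unfolding c1 c2[symmetric] by (simp only: ac_simps)
    finally have "(Suc j choose t) * C \<le> (j choose t) * ((n - j) choose Suc m)"
      by (simp only: mult_le_cancel1) simp
    also have "\<dots> < (n - t) choose (k - t)" using step.IH k(2) by simp
    finally show ?case unfolding C_def k(3) .
  qed
qed

lemma eq_if_square_le_mult:
  fixes a b c :: nat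
  assumes "a \<le> c" "b \<le> c" "c\<^sup>2 \<le> a * b" "0 < c"
  shows "a = c \<and> b = c"
proof -
  have cc: "c * c \<le> a * b" using assms(3) by (simp add: power2_eq_square)
  have "c * c \<le> c * b" by (rule order_trans[OF cc mult_le_mono1[OF assms(1)]])
  moreover have "c * c \<le> a * c" by (rule order_trans[OF cc mult_le_mono2[OF assms(2)]])
  ultimately show ?thesis using assms by simp
qed

lemma optimal_square_le:
  assumes "optimal_pair n k t \<A> \<B>" "t \<le> k" "t \<le> n"
  shows "((n - t) choose (k - t))\<^sup>2 \<le> card \<A> * card \<B>"
proof -
  have S: "{1..t} \<subseteq> {1..n}" using assms by auto
  have "{1..t} \<subseteq> F \<inter> G" if "F \<in> heavy n k t {1..t}" "G \<in> heavy n k t {1..t}" for F G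
    using that card_seteq[of "{1..t}" "F \<inter> {1..t}"] card_seteq[of "{1..t}" "G \<inter> {1..t}"]
    by (auto simp: heavy_def)
  moreover have "finite (F \<inter> G)" if "F \<in> heavy n k t {1..t}" for F G
    using that by (auto simp: heavy_def nsets_def)
  ultimately have "cross_intersecting t (heavy n k t {1..t}) (heavy n k t {1..t})"
    unfolding cross_intersecting_def using card_mono[of _ "{1..t}"] by fastforce
  moreover have "heavy n k t {1..t} \<subseteq> nsets {1..n} k" by (auto simp: heavy_def)
  ultimately have "card (heavy n k t {1..t}) * card (heavy n k t {1..t}) \<le> card \<A> * card \<B>"
    using assms(1) by (simp add: optimal_pair_def)
  then show ?thesis using card_heavy_0[OF S, of t k] assms by (simp add: power2_eq_square)
qed

section \<open>Critical traces of an optimal shifted pair\<close>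

text \<open>The hypotheses are symmetric in the two families, so \<open>commute\<close> makes every
  fact available with the roles exchanged. Minimality of \<open>l\<close> enters later, through a
  nonempty \<open>star\<close>.\<close>

locale determined_pair =
  fixes n k t l :: nat and \<A> \<B> :: "nat set set"
  assumes opt: "optimal_pair n k t \<A> \<B>"
    and shifted: "shifted n \<A>" "shifted n \<B>"
    and traceA: "F \<in> \<A> \<Longrightarrow> F \<inter> {1..l} \<in> gens n k l \<A>"
    and traceB: "F \<in> \<B> \<Longrightarrow> F \<inter> {1..l} \<in> gens n k l \<B>"
    and l: "t < l" "l \<le> n"
    and t: "5 \<le> t" and k: "2 * t < k" and n: "(t + 1) * (k - t + 1) \<le> n"
begin

lemma commute: "determined_pair n k t l \<B> \<A>"
  by unfold_locales (use opt shifted traceA traceB l t k n optimal_pair_commute in auto)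

lemma two_k_le_n: "2 * k \<le> n"
proof -
  have "6 * (k - t + 1) \<le> (t + 1) * (k - t + 1)" using t by (intro mult_right_mono) auto
  then show ?thesis using n k by simp
qed

lemma subA: "\<A> \<subseteq> nsets {1..n} k" and subB: "\<B> \<subseteq> nsets {1..n} k" and cross: "cross_intersecting t \<A> \<B>"
  using opt by (auto simp: optimal_pair_def)

lemma optD:
  assumes "\<A>' \<subseteq> nsets {1..n} k" "\<B>' \<subseteq> nsets {1..n} k" "cross_intersecting t \<A>' \<B>'"
  shows "card \<A>' * card \<B>' \<le> card \<A> * card \<B>"
  using opt assms by (auto simp: optimal_pair_def)

lemma finiteA: "finite \<A>" and finiteB: "finite \<B>"
  using subA subB by (auto intro: finite_subset)

lemma square_le: "((n - t) choose (k - t))\<^sup>2 \<le> card \<A> * card \<B>"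
  by (rule optimal_square_le[OF opt]) (use k l in auto)

lemma choose_pos: "0 < (n - t) choose (k - t)"
  using two_k_le_n by simp

lemma cardA_pos: "0 < card \<A>" and cardB_pos: "0 < card \<B>"
proof -
  have "0 < card \<A> * card \<B>" using square_le choose_pos zero_less_power[of "(n - t) choose (k - t)" 2] by linarith
  then show "0 < card \<A>" "0 < card \<B>" by simp_all
qed

lemma gens_cross_card: "X \<in> gens n k l \<A> \<Longrightarrow> Y \<in> gens n k l \<B> \<Longrightarrow> t \<le> card (X \<inter> Y)"
  using gens_cross[OF _ _ cross l(2) two_k_le_n] .

text \<open>A point outside \<open>X \<union> Y\<close> could replace \<open>l\<close> in
  \<open>X\<close>, and the resulting generator would meet \<open>Y\<close> in only
  \<open>t - 1\<close> points.\<close>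

lemma tight_union:
  assumes "X \<in> gens n k l \<A>" "Y \<in> gens n k l \<B>" "l \<in> X" "l \<in> Y" "card (X \<inter> Y) = t"
  shows "X \<union> Y = {1..l}" "card X + card Y = l + t"
proof -
  note X = gensD[OF assms(1)] and Y = gensD[OF assms(2)]
  show *: "X \<union> Y = {1..l}"
  proof (rule ccontr)
    assume "X \<union> Y \<noteq> {1..l}"
    then have "\<not> {1..l} \<subseteq> X \<union> Y" using X(1) Y(1) by blast
    then obtain c where c: "c \<in> {1..l}" "c \<notin> X" "c \<notin> Y" by blast
    then have "c < l" using assms by (cases "c = l") auto
    then have "insert c (X - {l}) \<in> gens n k l \<A>"
      using c assms by (intro gens_shift[OF assms(1) shifted(1) l(2)]) auto
    then have "t \<le> card (insert c (X - {l}) \<inter> Y)" using gens_cross_card assms by blast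
    moreover have "insert c (X - {l}) \<inter> Y = X \<inter> Y - {l}" using c by auto
    ultimately show False using assms X t by simp
  qed
  have "card X + card Y = card (X \<union> Y) + card (X \<inter> Y)" using X Y by (intro card_Un_Int) auto
  then show "card X + card Y = l + t" using * assms by simp
qed

text \<open>By optimality \<open>\<A>\<close> cannot be enlarged: a \<open>k\<close>-set outside
  \<open>\<A>\<close> over \<open>X - {l}\<close> fails against some \<open>G\<close> in
  \<open>\<B>\<close>, and the trace of \<open>G\<close> is a partner because \<open>X\<close>
  satisfies the bound only thanks to \<open>l\<close>.\<close>

lemma star_partner:
  assumes "X \<in> star n k l \<A>"
  obtains Y where "Y \<in> star n k l \<B>" "card X + card Y = l + t" "card (X \<inter> Y) = t"
proof -
  have X: "X \<in> gens n k l \<A>" "l \<in> X" "X - {l} \<notin> gens n k l \<A>" using assms by (auto simp: star_def)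
  note X' = gensD[OF X(1)]
  have "card (X - {l}) \<le> k" using X' card_mono[of X "X - {l}"] by fastforce
  then obtain F where F: "F \<in> nsets {1..n} k" "X - {l} \<subseteq> F" "F \<notin> \<A>"
    using X X' by (auto simp: gens_def)
  have "\<exists>G\<in>\<B>. card (F \<inter> G) < t"
  proof (rule ccontr)
    assume "\<not> ?thesis"
    then have "cross_intersecting t (insert F \<A>) \<B>" using cross by (auto simp: cross_intersecting_def not_less)
    then have "card (insert F \<A>) * card \<B> \<le> card \<A> * card \<B>"
      using subA subB F by (intro optD) auto
    then show False using F cardB_pos finiteA by simp
  qed
  then obtain G where G: "G \<in> \<B>" "card (F \<inter> G) < t" by blast
  define Y where "Y = G \<inter> {1..l}"
  have Y: "Y \<in> gens n k l \<B>" unfolding Y_def by (rule traceB[OF G(1)])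
  have fF: "finite F" using F by (simp add: nsets_def)
  have "card ((X - {l}) \<inter> Y) \<le> card (F \<inter> G)"
    by (rule card_mono) (use F Y_def fF in auto)
  then have lt: "card ((X - {l}) \<inter> Y) < t" using G by simp
  have le: "t \<le> card (X \<inter> Y)" by (rule gens_cross_card[OF X(1) Y])
  have lY: "l \<in> Y"
  proof (rule ccontr)
    assume "l \<notin> Y"
    then have "(X - {l}) \<inter> Y = X \<inter> Y" by auto
    then show False using lt le by simp
  qed
  have "(X - {l}) \<inter> Y = X \<inter> Y - {l}" by auto
  then have eq: "card (X \<inter> Y) = t" using lt le lY X X' by simp
  have "Y - {l} \<notin> gens n k l \<B>"
  proof
    assume "Y - {l} \<in> gens n k l \<B>"
    then have "t \<le> card (X \<inter> (Y - {l}))" using gens_cross_card X by blast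
    moreover have "X \<inter> (Y - {l}) = (X - {l}) \<inter> Y" by auto
    ultimately show False using lt by simp
  qed
  then have "Y \<in> star n k l \<B>" using Y lY by (auto simp: star_def)
  then show ?thesis using that tight_union(2)[OF X(1) Y X(2) lY eq] eq by blast
qed

text \<open>The exchange step: generators of size \<open>i\<close> in \<open>\<A>\<close> lose the point \<open>l\<close>, and the only
  generators of \<open>\<B>\<close> this conflicts with are those of size \<open>l + t - i\<close>.\<close>

lemma exchange:
  assumes ij: "i + j = l + t" "1 \<le> i" "i \<le> k" "j \<le> k"
  defines "\<alpha> \<equiv> card {X \<in> star n k l \<A>. card X = i}" and "\<beta> \<equiv> card {Y \<in> star n k l \<B>. card Y = j}"
  shows "(card \<A> + \<alpha> * ((n - l) choose (k - (i - 1)))) * (card \<B> - \<beta> * ((n - l) choose (k - j)))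
      \<le> card \<A> * card \<B>"
    and "\<beta> * ((n - l) choose (k - j)) \<le> card \<B>"
proof -
  let ?X = "{X \<in> star n k l \<A>. card X = i}" and ?Y = "{Y \<in> star n k l \<B>. card Y = j}"
  let ?X' = "(\<lambda>X. X - {l}) ` ?X"
  let ?Q = "trace_family n k {1..l} ?X'" and ?P = "trace_family n k {1..l} ?Y"
  have ls: "{1..l} \<subseteq> {1..n}" using l by auto
  have inj: "inj_on (\<lambda>X. X - {l}) ?X" by (auto simp: inj_on_def star_def)
  have "card ?Q = card ?X' * ((n - card {1..l}) choose (k - (i - 1)))"
    using ij by (intro card_trace_family_level ls) (auto simp: starD(2,4) dest: subsetD[OF starD(3)])
  then have Q: "card ?Q = \<alpha> * ((n - l) choose (k - (i - 1)))"
    using card_image[OF inj] by (simp add: \<alpha>_def)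
  have "card ?P = card ?Y * ((n - card {1..l}) choose (k - j))"
    using ij by (intro card_trace_family_level ls) (auto dest: subsetD[OF starD(3)])
  then have P: "card ?P = \<beta> * ((n - l) choose (k - j))" by (simp add: \<beta>_def)
  have PB: "?P \<subseteq> \<B>" by (rule trace_family_gens) (auto simp: star_def)
  \<comment> \<open>This keeps the natural subtraction in the other claim from truncating, so that
    it can be transferred to the reals.\<close>
  then show "\<beta> * ((n - l) choose (k - j)) \<le> card \<B>" using P card_mono[OF finiteB] by metis
  have disj: "\<A> \<inter> ?Q = {}"
    using traceA by (force simp: trace_family_def star_def)
  have "cross_intersecting t (\<A> \<union> ?Q) (\<B> - ?P)"
    unfolding cross_intersecting_def
  proof (intro ballI)
    fix F G assume F: "F \<in> \<A> \<union> ?Q" and G: "G \<in> \<B> - ?P"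
    show "t \<le> card (F \<inter> G)"
    proof (cases "F \<in> \<A>")
      case True
      then show ?thesis using G cross by (auto simp: cross_intersecting_def)
    next
      case False
      then obtain X where X: "X \<in> star n k l \<A>" "card X = i" "F \<inter> {1..l} = X - {l}"
        and Fn: "F \<in> nsets {1..n} k" using F by (auto simp: trace_family_def)
      have X': "X \<in> gens n k l \<A>" "l \<in> X" using X by (auto simp: star_def)
      define Y where "Y = G \<inter> {1..l}"
      have Y: "Y \<in> gens n k l \<B>" unfolding Y_def by (rule traceB) (use G in auto)
      have "t \<le> card ((X - {l}) \<inter> Y)"
      \<comment> \<open>An essential \<open>Y\<close> of size other than \<open>j\<close> meets
        \<open>X\<close> in more than \<open>t\<close> points by \<open>tight_union\<close> and can
        afford the loss of \<open>l\<close>; any other \<open>Y\<close> still generates without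
        \<open>l\<close>.\<close>
      proof (cases "l \<in> Y \<and> Y - {l} \<notin> gens n k l \<B>")
        case True
        then have "Y \<in> star n k l \<B>" using Y by (auto simp: star_def)
        moreover have "Y \<notin> ?Y" using G subB by (auto simp: trace_family_def Y_def)
        ultimately have "card Y \<noteq> j" by simp
        then have "card (X \<inter> Y) \<noteq> t" using tight_union(2)[OF X'(1) Y X'(2)] True X(2) ij(1) by linarith
        moreover have "t \<le> card (X \<inter> Y)" by (rule gens_cross_card[OF X'(1) Y])
        moreover have "(X - {l}) \<inter> Y = X \<inter> Y - {l}" by auto
        ultimately show ?thesis using True X' gensD(3)[OF Y] by simp
      next
        case False
        then consider "l \<notin> Y" | "Y - {l} \<in> gens n k l \<B>" by blast
        then show ?thesis
        proof cases
          case 1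
          then have "(X - {l}) \<inter> Y = X \<inter> Y" by auto
          then show ?thesis using gens_cross_card[OF X'(1) Y] by simp
        next
          case 2
          moreover have "(X - {l}) \<inter> Y = X \<inter> (Y - {l})" by auto
          ultimately show ?thesis using gens_cross_card[OF X'(1) 2] by simp
        qed
      qed
      also have "card ((X - {l}) \<inter> Y) \<le> card (F \<inter> G)"
        by (rule card_mono) (use Fn X Y_def in \<open>auto simp: nsets_def\<close>)
      finally show ?thesis .
    qed
  qed
  then have "card (\<A> \<union> ?Q) * card (\<B> - ?P) \<le> card \<A> * card \<B>"
    using subA subB by (intro optD) (auto simp: trace_family_def)
  moreover have "card (\<A> \<union> ?Q) = card \<A> + card ?Q"
    using disj finiteA by (intro card_Un_disjoint) (auto simp: trace_family_def)
  moreover have "card (\<B> - ?P) = card \<B> - card ?P"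
    using PB finiteB by (intro card_Diff_subset) (auto intro: finite_subset)
  ultimately show "(card \<A> + \<alpha> * ((n - l) choose (k - (i - 1)))) * (card \<B> - \<beta> * ((n - l) choose (k - j)))
      \<le> card \<A> * card \<B>" using P Q by simp
qed

text \<open>Double counting the moves of \<open>l\<close> into a gap below \<open>l\<close>.\<close>

lemma star_level_bound:
  assumes i: "i \<le> k" "i \<le> l"
  defines "\<alpha> \<equiv> card {X \<in> star n k l \<A>. card X = i}"
  shows "l * (\<alpha> * ((n - l) choose (k - i))) \<le> i * card \<A>"
proof -
  let ?X = "{X \<in> star n k l \<A>. card X = i}"
  let ?Z = "{Z \<in> gens n k l \<A>. l \<notin> Z \<and> card Z = i}"
  let ?c = "(n - l) choose (k - i)"
  have ls: "{1..l} \<subseteq> {1..n}" using l by auto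
  have fX: "finite ?X" by simp
  have fZ: "finite ?Z" by simp
  have Xg: "X \<subseteq> {1..l} \<and> finite X \<and> X \<in> gens n k l \<A> \<and> l \<in> X" if "X \<in> ?X" for X
    using that starD[of X n k l \<A>] by blast
  \<comment> \<open>Recording \<open>c\<close> makes the move injective; each \<open>X\<close> has
    \<open>l - i\<close> gaps, and each image offers only \<open>i\<close> candidates for
    \<open>c\<close>.\<close>
  have "card (SIGMA X:?X. {1..l} - X) \<le> card (SIGMA Z:?Z. Z)"
  proof (rule card_inj_on_le[where f = "\<lambda>(X, c). (insert c (X - {l}), c)"])
    show "inj_on (\<lambda>(X, c). (insert c (X - {l}), c)) (SIGMA X:?X. {1..l} - X)"
    proof (rule inj_onI)
      fix p p' assume "p \<in> (SIGMA X:?X. {1..l} - X)" "p' \<in> (SIGMA X:?X. {1..l} - X)"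
        and eq: "(\<lambda>(X, c). (insert c (X - {l}), c)) p = (\<lambda>(X, c). (insert c (X - {l}), c)) p'"
      then obtain X X' c where p: "p = (X, c)" "p' = (X', c)" and X: "X \<in> star n k l \<A>" "X' \<in> star n k l \<A>"
        and c: "c \<notin> X" "c \<notin> X'" by auto
      have "insert c (X - {l}) = insert c (X' - {l})" using eq p by simp
      then have "X - {l} = X' - {l}" using c by (metis Diff_iff Diff_insert_absorb)
      then have "X = X'" using starD(2)[OF X(1)] starD(2)[OF X(2)] by (metis insert_Diff)
      then show "p = p'" using p by simp
    qed
    show "(\<lambda>(X, c). (insert c (X - {l}), c)) ` (SIGMA X:?X. {1..l} - X) \<subseteq> (SIGMA Z:?Z. Z)"
    proof (rule image_subsetI)
      fix p assume "p \<in> (SIGMA X:?X. {1..l} - X)"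
      then obtain X c where p: "p = (X, c)" and X: "X \<in> star n k l \<A>" "card X = i" and c: "c \<in> {1..l}" "c \<notin> X"
        by auto
      note Xg = starD[OF X(1)]
      then have "c < l" using c by (cases "c = l") auto
      then have "insert c (X - {l}) \<in> gens n k l \<A>"
        using Xg c by (intro gens_shift[OF _ shifted(1) l(2)]) auto
      moreover have "card (insert c (X - {l})) = card X"
        using card_transpose_image[of c l X] transpose_image_eq_insert[of l X c] Xg c by simp
      ultimately show "(\<lambda>(X, c). (insert c (X - {l}), c)) p \<in> (SIGMA Z:?Z. Z)"
        using \<open>c < l\<close> X p by simp
    qed
    show "finite (SIGMA Z:?Z. Z)" using fZ gensD(3) by (intro finite_SigmaI) auto
  qed
  moreover have "card (SIGMA X:?X. {1..l} - X) = (\<Sum>X\<in>?X. card ({1..l} - X))"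
    by (rule card_SigmaI) (use fX in auto)
  moreover have "(\<Sum>X\<in>?X. card ({1..l} - X)) = (\<Sum>X\<in>?X. l - i)"
    using Xg by (intro sum.cong refl) (auto simp: card_Diff_subset)
  moreover have "card (SIGMA Z:?Z. Z) = (\<Sum>Z\<in>?Z. card Z)"
    by (rule card_SigmaI) (use fZ gensD(3) in auto)
  ultimately have le: "\<alpha> * (l - i) \<le> card ?Z * i" by (simp add: \<alpha>_def)
  have "trace_family n k {1..l} (?X \<union> ?Z) \<subseteq> \<A>"
    by (rule trace_family_gens) (auto simp: star_def)
  then have "card (trace_family n k {1..l} (?X \<union> ?Z)) \<le> card \<A>" using finiteA by (rule card_mono[rotated])
  moreover have "card (trace_family n k {1..l} (?X \<union> ?Z)) = card (?X \<union> ?Z) * ((n - card {1..l}) choose (k - i))"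
    using i by (intro card_trace_family_level ls) (auto dest: subsetD[OF starD(3)] subsetD[OF gensD(1)])
  moreover have "card (?X \<union> ?Z) = card ?X + card ?Z"
    by (rule card_Un_disjoint) (auto simp: star_def)
  ultimately have "(\<alpha> + card ?Z) * ?c \<le> card \<A>" by (simp add: \<alpha>_def)
  then have "i * ((\<alpha> + card ?Z) * ?c) \<le> i * card \<A>" by (rule mult_le_mono2)
  moreover have "l * \<alpha> \<le> i * (\<alpha> + card ?Z)"
  proof -
    have "\<alpha> * (l - i) + \<alpha> * i = \<alpha> * l" using i by (simp flip: add_mult_distrib2)
    then show ?thesis using le by (simp add: algebra_simps)
  qed
  then have "l * \<alpha> * ?c \<le> i * (\<alpha> + card ?Z) * ?c" by (rule mult_le_mono1)
  ultimately show ?thesis unfolding mult.assoc by (rule order_trans[rotated])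
qed

text \<open>Both exchanges are run for the sizes \<open>t + e\<close> and \<open>t + s\<close>.
  Dropping \<open>l\<close> gains \<open>\<alpha> * R\<close>, at least \<open>t\<close> times the
  mass \<open>\<alpha> * P\<close> of those traces, and costs \<open>\<beta> * P'\<close>; the
  reverse exchange has factor \<open>t - 1\<close>. Measured as fractions \<open>x\<close> and
  \<open>y\<close> of the families, this contradicts
  \<open>critical_weights_contradiction\<close>.\<close>

lemma star_sizes_small:
  assumes X: "X \<in> star n k l \<A>" and Y: "Y \<in> star n k l \<B>" and XY: "card X + card Y = l + t"
    and "card Y \<le> card X" "t < card Y"
  shows "card X = t + 1"
proof (rule ccontr)
  assume "card X \<noteq> t + 1"
  define e s where "e = card X - t" and "s = card Y - t"
  have es: "card X = t + e" "card Y = t + s" "1 \<le> s" "2 \<le> e" "s \<le> e"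
    using assms \<open>card X \<noteq> t + 1\<close> by (auto simp: e_def s_def)
  then have l': "l = t + e + s" using XY by simp
  have ik: "t + e \<le> k" "t + s \<le> k" using starD(5)[OF X] starD(5)[OF Y] es by auto
  interpret sw: determined_pair n k t l \<B> \<A> by (rule commute)
  let ?N = "n - l"
  define \<alpha> where "\<alpha> = card {X \<in> star n k l \<A>. card X = t + e}"
  define \<beta> where "\<beta> = card {Y \<in> star n k l \<B>. card Y = t + s}"
  have ab: "0 < \<alpha>" "0 < \<beta>" using X Y es by (auto simp: \<alpha>_def \<beta>_def card_gt_0_iff)
  define P where "P = ?N choose (k - (t + e))"
  define P' where "P' = ?N choose (k - (t + s))"
  define R where "R = ?N choose (k - (t + e - 1))"
  define R' where "R' = ?N choose (k - (t + s - 1))"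
  define q where "q = k - (t + e)"
  define q' where "q' = k - (t + s)"
  have kq: "k = t + e + q" "k = t + s + q'" using ik by (auto simp: q_def q'_def)
  have "k - t + 1 = e + q + 1" "k - t + 1 = s + q' + 1" using kq by simp_all
  then have n1: "(t + 1) * (e + q + 1) \<le> n" and n2: "(t + 1) * (s + q' + 1) \<le> n"
    using n by (simp_all only:)
  obtain e' where e': "e = 2 + e'" using es(4) le_Suc_ex by blast
  \<comment> \<open>With \<open>2 \<le> e\<close> and \<open>s \<le> e\<close>, the product
    \<open>t * e\<close> covers \<open>t + s\<close>, so the full factor \<open>t\<close> survives
    replacing \<open>n\<close> by \<open>n - l\<close>.\<close>
  have RP: "t * P \<le> R"
  proof -
    have "e' \<le> e' * t" using t by simp
    moreover have "t * e = 2 * t + e' * t" unfolding e' by (simp add: algebra_simps)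
    ultimately have "s + t \<le> t * e + 1" using es(5) e' t by linarith
    moreover have "(t + 1) * (e + q + 1) = t * e + t * Suc q + (e + q + 1)" by (simp add: algebra_simps)
    ultimately have "t * Suc q + (q + l) \<le> n" using n1 l' by linarith
    then have "t * Suc q \<le> ?N - q" by linarith
    then have "(t * Suc q) * P \<le> (?N - q) * P" by simp
    moreover have "(?N - q) * P = Suc q * (?N choose Suc q)" using Suc_times_choose_Suc[of q ?N] by (simp add: P_def q_def)
    moreover have "k - (t + e - 1) = Suc q" using kq(1) es(4) by linarith
    then have "?N choose Suc q = R" by (simp only: R_def)
    ultimately have "Suc q * (t * P) \<le> Suc q * R" by (simp only: mult.assoc mult.left_commute)
    then show ?thesis by (simp only: Suc_mult_le_cancel1)
  qed
  \<comment> \<open>For \<open>s = 1\<close> a large \<open>e\<close> would use up the slack. Since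
    \<open>e \<le> k - t\<close>, giving up one unit of the factor pays for it.\<close>
  have R'P': "(t - 1) * P' \<le> R'"
  proof -
    define u where "u = t - 1"
    have u: "t = u + 1" using t by (simp add: u_def)
    have "e \<le> s + q'" using kq by simp
    moreover have "(t + 1) * (s + q' + 1) = u * s + u * Suc q' + 2 * s + 2 * q' + 2"
      unfolding u by (simp add: algebra_simps)
    moreover have "u \<le> u * s" using es(3) by simp
    ultimately have "u * Suc q' + (q' + l) \<le> n" using n2 l' u by linarith
    then have "(t - 1) * Suc q' \<le> ?N - q'" unfolding u_def by linarith
    then have "((t - 1) * Suc q') * P' \<le> (?N - q') * P'" by simp
    moreover have "(?N - q') * P' = Suc q' * (?N choose Suc q')" using Suc_times_choose_Suc[of q' ?N] by (simp add: P'_def q'_def)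
    moreover have "k - (t + s - 1) = Suc q'" using kq(2) es(3) by linarith
    then have "?N choose Suc q' = R'" by (simp only: R'_def)
    ultimately have "Suc q' * ((t - 1) * P') \<le> Suc q' * R'" by (simp only: mult.assoc mult.left_commute)
    then show ?thesis by (simp only: Suc_mult_le_cancel1)
  qed
  have "q \<le> ?N" "q' \<le> ?N" using two_k_le_n l' kq t by linarith+
  then have P: "0 < P" "0 < P'" by (simp_all add: P_def P'_def q_def q'_def)
  define a where "a = real (card \<A>)"
  define b where "b = real (card \<B>)"
  have ab0: "0 < a" "0 < b" using cardA_pos cardB_pos by (simp_all add: a_def b_def)
  have ex1: "(a + real (\<alpha> * R)) * (b - real (\<beta> * P')) \<le> a * b"
  proof -
    have "(card \<A> + \<alpha> * R) * (card \<B> - \<beta> * P') \<le> card \<A> * card \<B>" "\<beta> * P' \<le> card \<B>"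
      using exchange[of "t + e" "t + s"] l' ik t by (simp_all add: \<alpha>_def \<beta>_def R_def P'_def)
    then have "real ((card \<A> + \<alpha> * R) * (card \<B> - \<beta> * P')) \<le> real (card \<A> * card \<B>)" by (simp only: of_nat_le_iff)
    then show ?thesis using \<open>\<beta> * P' \<le> card \<B>\<close>
      unfolding a_def b_def by (simp only: of_nat_mult of_nat_add of_nat_diff)
  qed
  have ex2: "(b + real (\<beta> * R')) * (a - real (\<alpha> * P)) \<le> b * a"
  proof -
    have "(card \<B> + \<beta> * R') * (card \<A> - \<alpha> * P) \<le> card \<B> * card \<A>" "\<alpha> * P \<le> card \<A>"
      using sw.exchange[of "t + s" "t + e"] l' ik t by (simp_all add: \<alpha>_def \<beta>_def R'_def P_def)
    then have "real ((card \<B> + \<beta> * R') * (card \<A> - \<alpha> * P)) \<le> real (card \<B> * card \<A>)" by (simp only: of_nat_le_iff)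
    then show ?thesis using \<open>\<alpha> * P \<le> card \<A>\<close>
      unfolding a_def b_def by (simp only: of_nat_mult of_nat_add of_nat_diff)
  qed
  define x where "x = real (\<alpha> * P) / a"
  define y where "y = real (\<beta> * P') / b"
  have xa: "real (\<alpha> * P) = x * a" and yb: "real (\<beta> * P') = y * b" using ab0 by (simp_all add: x_def y_def)
  have xy0: "0 < x" "0 < y" using ab P ab0 by (simp_all add: x_def y_def)
  have xl: "real (t + e + s) * x \<le> real (t + e)"
  proof -
    have "l * (\<alpha> * P) \<le> (t + e) * card \<A>"
      using star_level_bound[of "t + e"] ik l' by (simp add: \<alpha>_def P_def)
    then have "real l * real (\<alpha> * P) \<le> real (t + e) * a"
      unfolding a_def of_nat_mult[symmetric] by (simp only: of_nat_le_iff)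
    then have "(real l * x) * a \<le> real (t + e) * a" by (simp only: xa mult.assoc)
    then show ?thesis using ab0 l' by simp
  qed
  have yl: "real (t + e + s) * y \<le> real (t + s)"
  proof -
    have "l * (\<beta> * P') \<le> (t + s) * card \<B>"
      using sw.star_level_bound[of "t + s"] ik l' by (simp add: \<beta>_def P'_def)
    then have "real l * real (\<beta> * P') \<le> real (t + s) * b"
      unfolding b_def of_nat_mult[symmetric] by (simp only: of_nat_le_iff)
    then have "(real l * y) * b \<le> real (t + s) * b" by (simp only: yb mult.assoc)
    then show ?thesis using ab0 l' by simp
  qed
  have x1: "x \<le> 1"
  proof -
    have "real (t + e + s) * x \<le> real (t + e + s) * 1" using xl by simp
    then show ?thesis using t by (simp only: mult_le_cancel_left)
  qed
  have y1: "y \<le> 1"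
  proof -
    have "real (t + e + s) * y \<le> real (t + e + s) * 1" using yl by simp
    then show ?thesis using t by (simp only: mult_le_cancel_left)
  qed
  \<comment> \<open>Divided by \<open>a' * b'\<close>, the exchange reads
    \<open>(1 + c * x') * (1 - y') \<le> 1\<close>.\<close>
  have step: "c * x' * (1 - y') \<le> y'"
    if "(a' + r) * (b' - y' * b') \<le> a' * b'" "c * (x' * a') \<le> r" "0 < a'" "0 < b'" "y' \<le> 1" for a' b' r c x' y' :: real
  proof -
    have "(a' + c * (x' * a')) * (b' - y' * b') \<le> (a' + r) * (b' - y' * b')"
      using that mult_right_mono[of y' 1 b'] by (intro mult_right_mono) auto
    also have "\<dots> \<le> a' * b'" by fact
    finally have "(a' * b') * (c * x' * (1 - y')) \<le> (a' * b') * y'" by (simp add: algebra_simps)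
    then show ?thesis using that by simp
  qed
  have "real t * x * (1 - y) \<le> y"
  proof (rule step)
    show "(a + real (\<alpha> * R)) * (b - y * b) \<le> a * b" using ex1 unfolding yb .
    have "real t * real (\<alpha> * P) \<le> real (\<alpha> * R)"
      using mult_le_mono2[OF RP, of \<alpha>] unfolding of_nat_mult[symmetric] by (simp only: of_nat_le_iff mult.left_commute)
    then show "real t * (x * a) \<le> real (\<alpha> * R)" unfolding xa .
  qed (use ab0 y1 in auto)
  moreover have "(real t - 1) * y * (1 - x) \<le> x"
  proof (rule step)
    show "(b + real (\<beta> * R')) * (a - x * a) \<le> b * a" using ex2 unfolding xa .
    have "real (t - 1) * real (\<beta> * P') \<le> real (\<beta> * R')"
      using mult_le_mono2[OF R'P', of \<beta>] unfolding of_nat_mult[symmetric] by (simp only: of_nat_le_iff mult.left_commute)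
    then show "(real t - 1) * (y * b) \<le> real (\<beta> * R')" using t unfolding yb by (simp add: of_nat_diff)
  qed (use ab0 x1 in auto)
  ultimately show False
    using critical_weights_contradiction[of t s e x y] t es xy0 xl yl by blast
qed

text \<open>Otherwise \<open>[l]\<close> is the only generator of \<open>\<A>\<close>: closure under
  supersets puts \<open>l\<close> into each generator, and moving \<open>l\<close> into a gap would
  give one without it. Then \<open>\<A>\<close> consists of sets containing \<open>[l]\<close>,
  while \<open>\<B>\<close> lies in a union of \<open>l choose t\<close> families of size
  \<open>(n - t) choose (k - t)\<close>, and the product is too small.\<close>

lemma star_not_full:
  assumes "X \<in> star n k l \<A>"
  shows "card X < l"
proof (rule ccontr)
  assume "\<not> card X < l"
  note X = starD[OF assms]
  have "X = {1..l}" using card_seteq[OF _ X(3)] \<open>\<not> card X < l\<close> by simp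
  then have lk: "l \<le> k" and X0: "{1..l} \<in> gens n k l \<A>" "{1..l} - {l} \<notin> gens n k l \<A>"
    using X(5) assms by (auto simp: star_def)
  have no: "l \<in> Z" if "Z \<in> gens n k l \<A>" for Z
  proof (rule ccontr)
    assume "l \<notin> Z"
    then have "Z \<subseteq> {1..l} - {l}" using gensD(1)[OF that] by auto
    then have "{1..l} - {l} \<in> gens n k l \<A>" using lk l by (intro gens_mono[OF that]) auto
    then show False using X0 by simp
  qed
  have full: "Z = {1..l}" if Z: "Z \<in> gens n k l \<A>" for Z
  proof (rule ccontr)
    assume "Z \<noteq> {1..l}"
    then have "\<not> {1..l} \<subseteq> Z" using gensD(1)[OF Z] by blast
    then obtain c where c: "c \<in> {1..l}" "c \<notin> Z" by blast
    then have cl: "c < l" using no[OF Z] by (cases "c = l") auto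
    then have "insert c (Z - {l}) \<in> gens n k l \<A>"
      using c no[OF Z] by (intro gens_shift[OF Z shifted(1) l(2)]) auto
    then have "l \<in> insert c (Z - {l})" by (rule no)
    then show False using cl by simp
  qed
  have ls: "{1..l} \<subseteq> {1..n}" using l by auto
  have "\<A> \<subseteq> trace_family n k {1..l} {{1..l}}"
    using traceA full subA by (auto simp: trace_family_def)
  then have "card \<A> \<le> card (trace_family n k {1..l} {{1..l}})"
    by (rule card_mono[rotated]) (simp add: trace_family_def)
  also have "\<dots> = (n - l) choose (k - l)"
    using card_trace_family_level[OF ls, of "{{1..l}}" l k] lk by simp
  finally have a: "card \<A> \<le> (n - l) choose (k - l)" .
  have "\<B> \<subseteq> (\<Union>T\<in>{T. T \<subseteq> {1..l} \<and> card T = t}. heavy n k t T)"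
  proof
    fix G assume G: "G \<in> \<B>"
    then have "t \<le> card ({1..l} \<inter> (G \<inter> {1..l}))" using gens_cross_card[OF X0(1) traceB] by blast
    then obtain T where T: "T \<subseteq> {1..l} \<inter> (G \<inter> {1..l})" "card T = t" by (rule obtain_subset_with_card_n)
    then have "G \<inter> T = T" by auto
    then have "G \<in> heavy n k t T" using T G subB by (auto simp: heavy_def)
    then show "G \<in> (\<Union>T\<in>{T. T \<subseteq> {1..l} \<and> card T = t}. heavy n k t T)" using T by auto
  qed
  then have "card \<B> \<le> card (\<Union>T\<in>{T. T \<subseteq> {1..l} \<and> card T = t}. heavy n k t T)"
    by (rule card_mono[rotated]) auto
  also have "\<dots> \<le> (\<Sum>T\<in>{T. T \<subseteq> {1..l} \<and> card T = t}. card (heavy n k t T))"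
    by (rule card_UN_le) auto
  also have "\<dots> = (\<Sum>T\<in>{T. T \<subseteq> {1..l} \<and> card T = t}. (n - t) choose (k - t))"
    using ls k by (intro sum.cong refl card_heavy_0) auto
  also have "\<dots> = (l choose t) * ((n - t) choose (k - t))" by (simp add: n_subsets)
  finally have b: "card \<B> \<le> (l choose t) * ((n - t) choose (k - t))" .
  have "card \<A> * card \<B> \<le> ((n - l) choose (k - l)) * ((l choose t) * ((n - t) choose (k - t)))"
    using a b by (rule mult_le_mono)
  also have "\<dots> = ((l choose t) * ((n - l) choose (k - l))) * ((n - t) choose (k - t))" by simp
  also have "\<dots> < ((n - t) choose (k - t)) * ((n - t) choose (k - t))"
    using choose_mult_choose_less[OF n l(1) lk] choose_pos by (rule mult_less_mono1)
  finally show False using square_le by (simp add: power2_eq_square)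
qed

text \<open>Partner sizes sum to \<open>l + t\<close> and are both below \<open>l\<close>, hence
  both above \<open>t\<close>; \<open>star_sizes_small\<close> then applies to the larger
  one.\<close>

lemma star_sizes:
  assumes "X \<in> star n k l \<A>"
  shows "card X = t + 1" "l = t + 2"
proof -
  interpret sw: determined_pair n k t l \<B> \<A> by (rule commute)
  obtain Y where Y: "Y \<in> star n k l \<B>" "card X + card Y = l + t" using star_partner[OF assms] by blast
  have lt: "card X < l" "card Y < l" using star_not_full[OF assms] sw.star_not_full[OF Y(1)] by auto
  have "card X = t + 1 \<and> card Y = t + 1"
  proof (cases "card Y \<le> card X")
    case True
    then have "card X = t + 1" using star_sizes_small[OF assms Y] lt Y by linarith
    then show ?thesis using True lt Y by linarith
  next
    case False
    then have "card Y = t + 1" using sw.star_sizes_small[OF Y(1) assms] lt Y by linarith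
    then show ?thesis using False lt Y by linarith
  qed
  then show "card X = t + 1" "l = t + 2" using Y by auto
qed

text \<open>\<open>X\<close> is \<open>[t + 2]\<close> without one point; moving
  \<open>t + 2\<close> or \<open>t + 1\<close> into that gap gives the two sets.\<close>

lemma gens_top:
  assumes "X \<in> star n k l \<A>"
  shows "{1..t + 1} \<in> gens n k l \<A>" "insert (t + 2) {1..t} \<in> gens n k l \<A>"
proof -
  note X = starD[OF assms] and sz = star_sizes[OF assms]
  have "card ({1..l} - X) = 1" using X sz by (simp add: card_Diff_subset)
  then obtain c where c: "{1..l} - X = {c}" by (rule card_1_singletonE)
  then have Xc: "X = {1..l} - {c}" "c \<in> {1..l}" using X by auto
  then have cl: "c < t + 2" using X(2) sz by (cases "c = l") auto
  have "insert c (X - {l}) \<in> gens n k l \<A>"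
    using Xc cl sz X by (intro gens_shift[OF X(1) shifted(1) l(2)]) auto
  moreover have "insert c (X - {l}) = {1..t + 1}" using Xc cl sz by auto
  ultimately show "{1..t + 1} \<in> gens n k l \<A>" by simp
  show "insert (t + 2) {1..t} \<in> gens n k l \<A>"
  proof (cases "c = t + 1")
    case True
    then have "X = insert (t + 2) {1..t}" using Xc sz by auto
    then show ?thesis using X by simp
  next
    case False
    then have "insert c (X - {t + 1}) \<in> gens n k l \<A>"
      using Xc cl sz X by (intro gens_shift[OF X(1) shifted(1) l(2)]) auto
    moreover have "insert c (X - {t + 1}) = insert (t + 2) {1..t}" using Xc cl sz False by auto
    ultimately show ?thesis by simp
  qed
qed

text \<open>A generator with at most \<open>t\<close> points lies inside every generator of the
  other family, in particular inside the two of \<open>gens_top\<close>, whose intersection is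
  \<open>{1..t}\<close>.\<close>

lemma gens_dichotomy:
  assumes "Y \<in> star n k l \<B>" and Z: "Z \<in> gens n k l \<A>"
  shows "Z = {1..t} \<or> t + 1 \<le> card Z"
proof (rule disjCI)
  assume small: "\<not> t + 1 \<le> card Z"
  interpret sw: determined_pair n k t l \<B> \<A> by (rule commute)
  note fZ = gensD(3)[OF Z]
  have sub: "Z \<subseteq> U" "card Z = t" if "U \<in> gens n k l \<B>" for U
  proof -
    have "t \<le> card (Z \<inter> U)" by (rule gens_cross_card[OF Z that])
    moreover have "card (Z \<inter> U) \<le> card Z" using fZ by (intro card_mono) auto
    ultimately show "card Z = t" using small by simp
    then have "Z \<inter> U = Z" using \<open>t \<le> card (Z \<inter> U)\<close> fZ by (intro card_seteq) auto
    then show "Z \<subseteq> U" by auto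
  qed
  have "Z \<subseteq> {1..t + 1} \<inter> insert (t + 2) {1..t}" using sub(1) sw.gens_top[OF assms(1)] by blast
  also have "\<dots> = {1..t}" by auto
  finally show "Z = {1..t}" using sub(2)[OF sw.gens_top(1)[OF assms(1)]] by (intro card_seteq) auto
qed

text \<open>If \<open>{1..t}\<close> generated \<open>\<A>\<close>, it would lie in every generator
  of \<open>\<B>\<close>. This trades a gain of at most \<open>t * P\<close> over \<open>C\<close>
  in \<open>\<A>\<close> for a loss of at least \<open>t * P\<close> in \<open>\<B>\<close>, so the
  product drops below \<open>C * C\<close>.\<close>

lemma initial_segment_not_gen:
  assumes "X \<in> star n k l \<A>" "Y \<in> star n k l \<B>"
  shows "{1..t} \<notin> gens n k l \<A>"
proof
  assume T: "{1..t} \<in> gens n k l \<A>"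
  interpret sw: determined_pair n k t l \<B> \<A> by (rule commute)
  have l2: "l = t + 2" by (rule star_sizes[OF assms(1)])
  have ls: "{1..l} \<subseteq> {1..n}" using l by auto
  have k2: "t + 2 \<le> k" using k t by simp
  have sup: "{1..t} \<subseteq> Z" if "Z \<in> gens n k l \<B>" for Z
  proof -
    have "{1..t} \<inter> Z = {1..t}" using gens_cross_card[OF T that] by (intro card_seteq) auto
    then show ?thesis by blast
  qed
  have notB: "{1..t} \<notin> gens n k l \<B>"
  proof
    assume *: "{1..t} \<in> gens n k l \<B>"
    \<comment> \<open>Deleting \<open>l = t + 2\<close> from this \<open>Y\<close> would leave the
      generator \<open>{1..t}\<close>, although \<open>l\<close> is essential in
      \<open>Y\<close>.\<close>
    have "insert (t + 2) {1..t} = Y"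
      using sup[OF starD(1)[OF assms(2)]] starD[OF assms(2)] sw.star_sizes[OF assms(2)] by (intro card_seteq) auto
    moreover have "insert (t + 2) {1..t} - {l} = {1..t}" using l2 by auto
    ultimately show False using assms(2) * by (auto simp: star_def)
  qed
  define N where "N = n - (t + 2)"
  define P where "P = N choose (k - (t + 1))"
  define P2 where "P2 = N choose (k - (t + 2))"
  define Q where "Q = N choose (k - t)"
  define C where "C = (n - t) choose (k - t)"
  have C: "C = Q + 2 * P + P2" using choose_two_step[OF k2, of n] l l2 by (simp add: C_def Q_def P_def P2_def N_def)
  have tP: "t * P \<le> Q" using choose_ratio_ge(1)[OF k2 n] by (simp add: Q_def P_def N_def)
  have "k - (t + 1) \<le> N" using two_k_le_n k by (simp add: N_def)
  then have P0: "0 < P" by (simp add: P_def)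
  have "Z \<in> {{1..t + 1}, insert (t + 2) {1..t}, {1..l}}" if Z: "Z \<in> gens n k l \<B>" for Z
  proof -
    note Zl = gensD(1)[OF Z, unfolded l2] and Zt = sup[OF Z]
    show ?thesis
    proof (cases "t + 1 \<in> Z")
      case True
      show ?thesis
      proof (cases "t + 2 \<in> Z")
        case True': True
        have "Z = {1..l}"
        proof
          show "{1..l} \<subseteq> Z"
          proof
            fix x assume "x \<in> {1..l}"
            then have "x \<in> {1..t} \<or> x = t + 1 \<or> x = t + 2" using l2 by auto
            then show "x \<in> Z" using Zt True True' by blast
          qed
        qed (use Zl l2 in simp)
        then show ?thesis by simp
      next
        case False
        have "Z = {1..t + 1}"
        proof
          show "Z \<subseteq> {1..t + 1}"
          proof
            fix x assume "x \<in> Z"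
            moreover from this have "x \<noteq> t + 2" using False by blast
            ultimately show "x \<in> {1..t + 1}" using Zl by fastforce
          qed
          show "{1..t + 1} \<subseteq> Z"
          proof
            fix x assume "x \<in> {1..t + 1}"
            then have "x \<in> {1..t} \<or> x = t + 1" by auto
            then show "x \<in> Z" using Zt True by blast
          qed
        qed
        then show ?thesis by simp
      qed
    next
      case False
      have sub: "Z \<subseteq> insert (t + 2) {1..t}"
      proof
        fix x assume "x \<in> Z"
        moreover from this have "x \<noteq> t + 1" using False by blast
        ultimately show "x \<in> insert (t + 2) {1..t}" using Zl by fastforce
      qed
      moreover have "Z \<noteq> {1..t}" using Z notB by blast
      ultimately have "Z = insert (t + 2) {1..t}" using Zt by blast
      then show ?thesis by simp
    qed
  qed
  then have gB: "F \<inter> {1..l} \<in> {{1..t + 1}, insert (t + 2) {1..t}, {1..l}}" if "F \<in> \<B>" for F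
    using traceB[OF that] by blast
  have "\<B> \<subseteq> trace_family n k {1..l} {{1..t + 1}, insert (t + 2) {1..t}, {1..l}}"
  proof
    fix F assume "F \<in> \<B>"
    then show "F \<in> trace_family n k {1..l} {{1..t + 1}, insert (t + 2) {1..t}, {1..l}}"
      unfolding trace_family_def using gB[of F] subB by blast
  qed
  then have "card \<B> \<le> card (trace_family n k {1..l} {{1..t + 1}, insert (t + 2) {1..t}, {1..l}})"
    by (rule card_mono[rotated]) (simp add: trace_family_def)
  also have "\<dots> = (\<Sum>X\<in>{{1..t + 1}, insert (t + 2) {1..t}, {1..l}}. (n - card {1..l}) choose (k - card X))"
    using k2 l2 by (intro card_trace_family ls) auto
  also have "\<dots> = 2 * P + P2"
  proof -
    have mem: "t + 1 \<notin> insert (t + 2) {1..t}" "t + 2 \<notin> {1..t + 1}" "t + 1 \<in> {1..t + 1}" "t + 1 \<in> {1..l}" "t + 2 \<in> {1..l}"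
      using l2 by auto
    have differ: "U \<noteq> V" if "x \<in> U" "x \<notin> V" for x :: nat and U V using that by blast
    note ne = differ[OF mem(3,1)] differ[OF mem(5,2), symmetric] differ[OF mem(4,1), symmetric]
    have c: "card {1..t + 1} = t + 1" "card (insert (t + 2) {1..t}) = t + 1" "card {1..l} = t + 2"
      using l2 by simp_all
    have "{1..t + 1} \<notin> {insert (t + 2) {1..t}, {1..l}}" "insert (t + 2) {1..t} \<notin> {{1..l}}" using ne by simp_all
    then show ?thesis by (simp only: sum.insert finite.intros sum.empty c P_def P2_def N_def) (simp add: l2)
  qed
  finally have b: "card \<B> \<le> 2 * P + P2" .
  have "\<A> \<subseteq> trace_family n k {1..l} {{1..t}} \<union> heavy n k (t + 1) {1..l}"
  proof
    fix F assume F: "F \<in> \<A>"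
    then show "F \<in> trace_family n k {1..l} {{1..t}} \<union> heavy n k (t + 1) {1..l}"
      using gens_dichotomy[OF assms(2) traceA[OF F]] subA by (auto simp: trace_family_def heavy_def)
  qed
  then have "card \<A> \<le> card (trace_family n k {1..l} {{1..t}} \<union> heavy n k (t + 1) {1..l})"
    by (rule card_mono[rotated]) (simp add: trace_family_def)
  also have "\<dots> \<le> card (trace_family n k {1..l} {{1..t}}) + card (heavy n k (t + 1) {1..l})"
    by (rule card_Un_le)
  also have "card (trace_family n k {1..l} {{1..t}}) = Q"
    using card_trace_family_level[OF ls, of "{{1..t}}" t k] k l2 by (simp add: Q_def N_def)
  also have "card (heavy n k (t + 1) {1..l}) = (t + 2) * P + P2"
    using card_heavy_1[OF ls _ k2] l2 by (simp add: P_def P2_def N_def)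
  finally have a: "card \<A> \<le> C + t * P" by (simp add: C algebra_simps)
  have b': "card \<B> + t * P \<le> C" using b tP C by simp
  have "(card \<A> * card \<B> + (t * P) * (t * P)) \<le> (C + t * P) * card \<B> + (t * P) * (t * P)"
    using a by simp
  also have "\<dots> \<le> C * C"
  proof -
    obtain g where g: "C = card \<B> + t * P + g" using b' le_Suc_ex by blast
    show ?thesis unfolding g by (simp add: algebra_simps)
  qed
  finally have "card \<A> * card \<B> + (t * P) * (t * P) \<le> C * C" .
  moreover have "0 < (t * P) * (t * P)" using P0 t by simp
  ultimately have "card \<A> * card \<B> < C * C" by linarith
  then show False using square_le by (simp add: C_def power2_eq_square)
qed

text \<open>With \<open>{1..t}\<close> excluded, the dichotomy places both families in one heavy
  family of at most \<open>C\<close> sets, and the lower bound on the product leaves no gap.\<close>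

lemma two_step_structure:
  assumes "X \<in> star n k l \<A>"
  shows "\<A> = heavy n k (t + 1) {1..t + 2}" "\<B> = heavy n k (t + 1) {1..t + 2}" "n = (t + 1) * (k - t + 1)"
proof -
  interpret sw: determined_pair n k t l \<B> \<A> by (rule commute)
  obtain Y where Y: "Y \<in> star n k l \<B>" using star_partner[OF assms] by blast
  have l2: "l = t + 2" by (rule star_sizes[OF assms])
  have ls: "{1..t + 2} \<subseteq> {1..n}" using l l2 by auto
  have k2: "t + 2 \<le> k" using k t by simp
  define C where "C = (n - t) choose (k - t)"
  define h where "h = card (heavy n k (t + 1) {1..t + 2})"
  have A: "\<A> \<subseteq> heavy n k (t + 1) {1..t + 2}"
  proof
    fix F assume F: "F \<in> \<A>"
    have "F \<inter> {1..l} \<noteq> {1..t}" using initial_segment_not_gen[OF assms Y] traceA[OF F] by metis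
    then show "F \<in> heavy n k (t + 1) {1..t + 2}"
      using gens_dichotomy[OF Y traceA[OF F]] F subA l2 by (auto simp: heavy_def)
  qed
  have B: "\<B> \<subseteq> heavy n k (t + 1) {1..t + 2}"
  proof
    fix F assume F: "F \<in> \<B>"
    have "F \<inter> {1..l} \<noteq> {1..t}" using sw.initial_segment_not_gen[OF Y assms] traceB[OF F] by metis
    then show "F \<in> heavy n k (t + 1) {1..t + 2}"
      using sw.gens_dichotomy[OF assms traceB[OF F]] F subB l2 by (auto simp: heavy_def)
  qed
  have le: "card \<A> \<le> h" "card \<B> \<le> h" "h \<le> C"
    using A B card_mono[OF finite_heavy] card_heavy_1_le(1)[OF ls _ k2 n] by (auto simp: h_def C_def)
  have "card \<A> = C \<and> card \<B> = C"
    by (rule eq_if_square_le_mult) (use le square_le choose_pos in \<open>auto simp: C_def\<close>)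
  then have eq: "card \<A> = h" "card \<B> = h" "h = C" using le by auto
  show "\<A> = heavy n k (t + 1) {1..t + 2}" "\<B> = heavy n k (t + 1) {1..t + 2}"
    by (rule card_seteq[OF finite_heavy]; use A B eq in \<open>simp add: h_def\<close>)+
  show "n = (t + 1) * (k - t + 1)"
    using eq card_heavy_1_le(2)[OF ls _ k2 n] by (simp add: h_def C_def)
qed

end

text \<open>If \<open>l > t\<close>, minimality gives an essential trace in one family, and
  \<open>star_partner\<close> moves it to \<open>\<A>\<close> if necessary. If
  \<open>l \<le> t\<close>, having \<open>t\<close> common points within \<open>[l]\<close> forces
  every member to contain \<open>[t]\<close>.\<close>

lemma optimal_shifted:
  assumes opt: "optimal_pair n k t \<A> \<B>" and sh: "shifted n \<A>" "shifted n \<B>"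
    and t: "5 \<le> t" and k: "2 * t < k" and n: "(t + 1) * (k - t + 1) \<le> n"
  shows "\<exists>r\<le>1. \<exists>S\<subseteq>{1..n}. card S = t + 2 * r \<and> \<A> = heavy n k (t + r) S \<and> \<B> = heavy n k (t + r) S \<and>
    (r = 1 \<longrightarrow> n = (t + 1) * (k - t + 1))"
proof -
  define D where "D l \<longleftrightarrow> l \<le> n \<and> (\<forall>F\<in>\<A>. F \<inter> {1..l} \<in> gens n k l \<A>) \<and> (\<forall>F\<in>\<B>. F \<inter> {1..l} \<in> gens n k l \<B>)" for l
  have sub: "\<A> \<subseteq> nsets {1..n} k" "\<B> \<subseteq> nsets {1..n} k" and cross: "cross_intersecting t \<A> \<B>"
    using opt by (auto simp: optimal_pair_def)
  have full: "F \<inter> {1..n} \<in> gens n k n \<X>" if "\<X> \<subseteq> nsets {1..n} k" "F \<in> \<X>" for \<X> F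
  proof -
    have F: "F \<subseteq> {1..n}" "card F = k" using that by (auto simp: nsets_def)
    have "G \<in> \<X>" if G: "G \<in> nsets {1..n} k" "F \<subseteq> G" for G
    proof -
      have "F = G" using G F by (intro card_subset_eq) (auto simp: nsets_def)
      then show ?thesis using \<open>F \<in> \<X>\<close> by simp
    qed
    moreover have "F \<inter> {1..n} = F" using F by blast
    ultimately show ?thesis using F by (simp add: gens_def)
  qed
  have Dn: "D n" using full[OF sub(1)] full[OF sub(2)] by (simp add: D_def)
  define l where "l = (LEAST l. D l)"
  have Dl: "D l" unfolding l_def using Dn by (rule LeastI)
  have min: "\<not> D m" if "m < l" for m using not_less_Least that unfolding l_def by blast
  have det: "determined_pair n k t l \<A> \<B>" if "t < l"
    using assms that Dl by unfold_locales (auto simp: D_def)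
  show ?thesis
  proof (cases "t < l")
    case True
    interpret determined_pair n k t l \<A> \<B> by (rule det[OF True])
    interpret sw: determined_pair n k t l \<B> \<A> by (rule commute)
    have drop: "F \<inter> {1..l - 1} \<in> gens n k (l - 1) \<X>"
      if "star n k l \<X> = {}" "F \<inter> {1..l} \<in> gens n k l \<X>" for F \<X>
    proof -
      have "F \<inter> {1..l} - {l} \<in> gens n k l \<X>"
        using that by (cases "l \<in> F \<inter> {1..l}") (auto simp: star_def)
      moreover have "F \<inter> {1..l} - {l} = F \<inter> {1..l - 1}" by auto
      ultimately show ?thesis by (auto simp: gens_def)
    qed
    have "star n k l \<A> \<noteq> {} \<or> star n k l \<B> \<noteq> {}"
    proof (rule ccontr)
      assume "\<not> ?thesis"
      then have "D (l - 1)" using Dl drop unfolding D_def by auto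
      then show False using min[of "l - 1"] True by simp
    qed
    then obtain X where "X \<in> star n k l \<A>" using sw.star_partner by blast
    note two = two_step_structure[OF this] and l_eq = star_sizes(2)[OF this]
    have "{1..t + 2} \<subseteq> {1..n}" using l_eq l by simp
    then show ?thesis using two by (intro exI[of _ 1] conjI exI[of _ "{1..t + 2}"]) simp_all
  next
    case False
    have "1 * (k - t + 1) \<le> (t + 1) * (k - t + 1)" by (rule mult_right_mono) auto
    then have t_n: "t \<le> n" using n k by simp
    have "6 * (k - t + 1) \<le> (t + 1) * (k - t + 1)" using t by (intro mult_right_mono) auto
    then have n2: "2 * k \<le> n" using n k by simp
    define C where "C = (n - t) choose (k - t)"
    have C: "C\<^sup>2 \<le> card \<A> * card \<B>" using optimal_square_le[OF opt] k t_n by (simp add: C_def)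
    have C0: "0 < C" using n2 by (simp add: C_def)
    have "0 < C\<^sup>2" using C0 by simp
    then have "0 < card \<A> * card \<B>" using C by linarith
    then have ne: "\<A> \<noteq> {}" "\<B> \<noteq> {}" by auto
    have sub_heavy: "F \<in> heavy n k t {1..t} \<and> G \<in> heavy n k t {1..t}" if F: "F \<in> \<A>" "G \<in> \<B>" for F G
    proof -
      have "t \<le> card ((F \<inter> {1..l}) \<inter> (G \<inter> {1..l}))"
        using Dl F by (intro gens_cross[OF _ _ cross _ n2]) (auto simp: D_def)
      also have "\<dots> \<le> card ((F \<inter> G) \<inter> {1..t})" by (rule card_mono) (use False in auto)
      finally have le: "t \<le> card ((F \<inter> G) \<inter> {1..t})" .
      have "card ((F \<inter> G) \<inter> {1..t}) \<le> card (F \<inter> {1..t})" "card ((F \<inter> G) \<inter> {1..t}) \<le> card (G \<inter> {1..t})"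
        by (rule card_mono; auto)+
      then show ?thesis using le F sub by (auto simp: heavy_def)
    qed
    then have AB: "\<A> \<subseteq> heavy n k t {1..t}" "\<B> \<subseteq> heavy n k t {1..t}" using ne by auto
    have h: "card (heavy n k t {1..t}) = C" using card_heavy_0[of "{1..t}" n t k] t_n k by (simp add: C_def)
    have le: "card \<A> \<le> C" "card \<B> \<le> C"
      using card_mono[OF finite_heavy AB(1)] card_mono[OF finite_heavy AB(2)] h by simp_all
    have "card \<A> = C \<and> card \<B> = C" by (rule eq_if_square_le_mult[OF le C C0])
    then have "\<A> = heavy n k t {1..t}" "\<B> = heavy n k t {1..t}"
      using card_subset_eq[OF finite_heavy AB(1)] card_subset_eq[OF finite_heavy AB(2)] h by simp_all
    then show ?thesis using t_n by (intro exI[of _ 0] conjI exI[of _ "{1..t}"]) simp_all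
  qed
qed

section \<open>Undoing the shifts\<close>

lemma optimal_pair_shift:
  assumes "optimal_pair n k t \<A> \<B>" "i \<in> {1..n}" "j \<in> {1..n}"
  shows "optimal_pair n k t (shift i j \<A>) (shift i j \<B>)"
  using assms(1) shift_nsets[OF assms(2,3), of \<A> k] shift_nsets[OF assms(2,3), of \<B> k]
    shift_cross[of t \<A> \<B> i j]
  unfolding optimal_pair_def card_shift by simp

text \<open>Shifting keeps a pair optimal and lowers the sum of all elements, so the induction
  hypothesis describes the shifted pair and \<open>unshift_heavy\<close> carries the description
  back.\<close>

lemma optimal_structure:
  assumes t: "5 \<le> t" and k: "3 * t < k" and n: "(t + 1) * (k - t + 1) \<le> n"
  shows "optimal_pair n k t \<A> \<B> \<Longrightarrow>
    \<exists>r\<le>1. \<exists>S\<subseteq>{1..n}. card S = t + 2 * r \<and> \<A> = heavy n k (t + r) S \<and> \<B> = heavy n k (t + r) S \<and>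
      (r = 1 \<longrightarrow> n = (t + 1) * (k - t + 1))"
proof (induction "(\<Sum>F\<in>\<A>. \<Sum>F) + (\<Sum>F\<in>\<B>. \<Sum>F)" arbitrary: \<A> \<B> rule: less_induct)
  case less
  have AB: "\<A> \<subseteq> nsets {1..n} k" "\<B> \<subseteq> nsets {1..n} k" "cross_intersecting t \<A> \<B>"
    using less.prems by (auto simp: optimal_pair_def)
  have fin: "finite \<A>" "finite \<B>" using finite_subset[OF AB(1)] finite_subset[OF AB(2)] by simp_all
  have finF: "finite F" if "F \<in> \<A> \<or> F \<in> \<B>" for F using that AB by (auto simp: nsets_def)
  show ?case
  proof (cases "shifted n \<A> \<and> shifted n \<B>")
    case True
    then show ?thesis using optimal_shifted[OF less.prems] t k n by simp
  next
    case False
    then obtain i j where ij: "1 \<le> i" "i < j" "j \<le> n" and ne: "shift i j \<A> \<noteq> \<A> \<or> shift i j \<B> \<noteq> \<B>"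
      unfolding shifted_def by blast
    have ijn: "i \<in> {1..n}" "j \<in> {1..n}" using ij by auto
    have le: "(\<Sum>F\<in>shift i j \<A>. \<Sum>F) \<le> (\<Sum>F\<in>\<A>. \<Sum>F)" "(\<Sum>F\<in>shift i j \<B>. \<Sum>F) \<le> (\<Sum>F\<in>\<B>. \<Sum>F)"
      using fin finF ij(2) by (simp_all add: sum_shift_le)
    have "(\<Sum>F\<in>shift i j \<A>. \<Sum>F) + (\<Sum>F\<in>shift i j \<B>. \<Sum>F) < (\<Sum>F\<in>\<A>. \<Sum>F) + (\<Sum>F\<in>\<B>. \<Sum>F)"
    proof (cases "shift i j \<A> = \<A>")
      case True
      then have "(\<Sum>F\<in>shift i j \<B>. \<Sum>F) < (\<Sum>F\<in>\<B>. \<Sum>F)"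
        using ne fin finF ij(2) by (intro sum_shift_less) auto
      then show ?thesis using le by linarith
    next
      case False
      then have "(\<Sum>F\<in>shift i j \<A>. \<Sum>F) < (\<Sum>F\<in>\<A>. \<Sum>F)"
        using fin finF ij(2) by (intro sum_shift_less) auto
      then show ?thesis using le by linarith
    qed
    from less.hyps[OF this optimal_pair_shift[OF less.prems ijn]]
    obtain r S where r: "r \<le> 1" and S: "S \<subseteq> {1..n}" "card S = t + 2 * r"
      and sh: "shift i j \<A> = heavy n k (t + r) S" "shift i j \<B> = heavy n k (t + r) S"
      and n1: "r = 1 \<longrightarrow> n = (t + 1) * (k - t + 1)" by blast
    have "6 * (k - t + 1) \<le> (t + 1) * (k - t + 1)" using t by (intro mult_right_mono) auto
    then have n6: "6 * (k - t + 1) \<le> n" using n by (rule order_trans)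
    have bounds: "r + 1 \<le> t" "t + 2 * r \<le> k" "t + 2 * r + 3 * k < n"
      using k r t n6 by simp_all
    show ?thesis using unshift_heavy[OF ijn S bounds AB sh] r n1 by blast
  qed
qed

lemma ex_optimal_pair:
  assumes "\<A> \<subseteq> nsets {1..n} k" "\<B> \<subseteq> nsets {1..n} k" "cross_intersecting t \<A> \<B>"
  shows "\<exists>\<A>\<^sub>0 \<B>\<^sub>0. optimal_pair n k t \<A>\<^sub>0 \<B>\<^sub>0"
proof -
  let ?P = "\<lambda>(\<A>, \<B>). \<A> \<subseteq> nsets {1..n} k \<and> \<B> \<subseteq> nsets {1..n} k \<and> cross_intersecting t \<A> \<B>"
  let ?f = "\<lambda>(\<A>, \<B>). card \<A> * card \<B>"
  have bound: "?f p < card (nsets {1..n} k) * card (nsets {1..n} k) + 1" if "?P p" for p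
  proof -
    obtain \<A>' \<B>' where p: "p = (\<A>', \<B>')" by (cases p)
    then have "card \<A>' \<le> card (nsets {1..n} k)" "card \<B>' \<le> card (nsets {1..n} k)"
      using that by (intro card_mono; simp)+
    then have "card \<A>' * card \<B>' \<le> card (nsets {1..n} k) * card (nsets {1..n} k)" by (rule mult_le_mono)
    then show ?thesis using p by simp
  qed
  obtain p where "?P p" "\<forall>q. ?P q \<longrightarrow> ?f q \<le> ?f p"
    using ex_has_greatest_nat[of ?P "(\<A>, \<B>)" ?f "card (nsets {1..n} k) * card (nsets {1..n} k) + 1"] assms bound
    by auto
  moreover obtain \<A>\<^sub>0 \<B>\<^sub>0 where "p = (\<A>\<^sub>0, \<B>\<^sub>0)" by (cases p)
  ultimately have "optimal_pair n k t \<A>\<^sub>0 \<B>\<^sub>0" unfolding optimal_pair_def by simp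
  then show ?thesis by blast
qed

theorem theorem4p8:
  fixes t :: nat
  assumes "t \<ge> 14"
  shows "\<exists>k\<^sub>0::nat. \<forall>k n. k > k\<^sub>0 \<longrightarrow> n \<ge> (t + 1) * (k - t + 1) \<longrightarrow>
    (\<forall>\<A> \<B>. \<A> \<subseteq> nsets {1..n} k \<longrightarrow> \<B> \<subseteq> nsets {1..n} k \<longrightarrow> cross_intersecting t \<A> \<B> \<longrightarrow>
      card \<A> * card \<B> \<le> ((n - t) choose (k - t))\<^sup>2 \<and>
      (card \<A> * card \<B> = ((n - t) choose (k - t))\<^sup>2 \<longleftrightarrow>
        (\<A> = \<B> \<and> family_iso n \<B> (frankl_family 0 t n k)) \<or>
        (n = (t + 1) * (k - t + 1) \<and> \<A> = \<B> \<and> family_iso n \<B> (frankl_family 1 t n k))))"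
\<comment> \<open>Together with \<open>n \<ge> 6 * (k - t + 1)\<close>, \<open>k > 3 * t\<close>
  gives \<open>t + 2 + 3 * k < n\<close>, the room that \<open>ex_common_partner\<close> requires
  for its padding.\<close>
proof (intro exI[of _ "3 * t"] allI impI)
  fix k n :: nat and \<A> \<B> :: "nat set set"
  assume k: "3 * t < k" and n: "(t + 1) * (k - t + 1) \<le> n"
    and AB: "\<A> \<subseteq> nsets {1..n} k" "\<B> \<subseteq> nsets {1..n} k" "cross_intersecting t \<A> \<B>"
  have t: "5 \<le> t" and k2: "t \<le> k" "t + 2 \<le> k" using assms k by auto
  define C where "C = (n - t) choose (k - t)"
  have "6 * (k - t + 1) \<le> (t + 1) * (k - t + 1)" using t by (intro mult_right_mono) auto
  then have "6 * (k - t + 1) \<le> n" using n by (rule order_trans)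
  then have n2: "t + 2 \<le> n" using k by simp
  have card_heavy: "card (heavy n k (t + r) S) = C"
    if "r \<le> 1" "S \<subseteq> {1..n}" "card S = t + 2 * r" "r = 1 \<longrightarrow> n = (t + 1) * (k - t + 1)" for r S
  proof (cases "r = 0")
    case True
    then show ?thesis using card_heavy_0[OF that(2) _ k2(1)] that by (simp add: C_def)
  next
    case False
    then have "r = 1" using that by simp
    then show ?thesis using card_heavy_1_le(2)[OF that(2) _ k2(2) n] that unfolding C_def by simp
  qed
  \<comment> \<open>All maximisers share this value, so it bounds every pair, and a pair attaining
    it is itself a maximiser.\<close>
  have product: "card \<A>' * card \<B>' = C\<^sup>2" if "optimal_pair n k t \<A>' \<B>'" for \<A>' \<B>'
    using optimal_structure[OF t k n that] card_heavy by (auto simp: power2_eq_square)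
  obtain \<A>\<^sub>0 \<B>\<^sub>0 where opt: "optimal_pair n k t \<A>\<^sub>0 \<B>\<^sub>0" using ex_optimal_pair[OF AB] by blast
  then have le: "card \<A> * card \<B> \<le> C\<^sup>2"
    using AB product[OF opt] by (metis optimal_pair_def)
  have "card \<A> * card \<B> = C\<^sup>2 \<longleftrightarrow>
      (\<A> = \<B> \<and> (\<exists>S\<subseteq>{1..n}. card S = t + 2 * 0 \<and> \<B> = heavy n k (t + 0) S)) \<or>
      (n = (t + 1) * (k - t + 1) \<and> \<A> = \<B> \<and> (\<exists>S\<subseteq>{1..n}. card S = t + 2 * 1 \<and> \<B> = heavy n k (t + 1) S))"
    (is "?L \<longleftrightarrow> ?R")
  proof
    assume ?L
    then have "optimal_pair n k t \<A> \<B>"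
      using AB opt product[OF opt] by (simp add: optimal_pair_def)
    from optimal_structure[OF t k n this] obtain r S where r: "r \<le> 1" and S: "S \<subseteq> {1..n}" "card S = t + 2 * r"
      "\<A> = heavy n k (t + r) S" "\<B> = heavy n k (t + r) S" "r = 1 \<longrightarrow> n = (t + 1) * (k - t + 1)" by blast
    from r consider "r = 0" | "r = 1" by linarith
    then show ?R
    proof cases
      case 1
      then show ?thesis using S by blast
    next
      case 2
      then show ?thesis using S by blast
    qed
  next
    assume ?R
    then have "\<A> = \<B> \<and> card \<B> = C" using card_heavy[of 0] card_heavy[of 1] by auto
    then show ?L by (simp add: power2_eq_square)
  qed
  then show "card \<A> * card \<B> \<le> ((n - t) choose (k - t))\<^sup>2 \<and>
      (card \<A> * card \<B> = ((n - t) choose (k - t))\<^sup>2 \<longleftrightarrow>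
        (\<A> = \<B> \<and> family_iso n \<B> (frankl_family 0 t n k)) \<or>
        (n = (t + 1) * (k - t + 1) \<and> \<A> = \<B> \<and> family_iso n \<B> (frankl_family 1 t n k)))"
    using le n2 by (simp add: C_def family_iso_frankl_iff)
qed

end
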